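(* Let $M\subseteq K$ be a separable (not necessarily algebraic) extension of fields of characteristic $p>0$, let $m>0$ be an integer, and let $\partial=(\partial_i)_{i<p^m}$ be a $\mathbb{G}_{\rm m}[m]$-derivation on $K$ over $M$. Then $\partial$ can be expanded to a $\mathbb{G}_{\rm m}$-derivation on $K$ over $M$; that is, there is a $\mathbb{G}_{\rm m}$-derivation $D=(D_i)_{i\in\mathbb{N}}$ on $K$ over $M$ with $D_i=\partial_i$ for all $i<p^m$.
   Context: A $\mathbb{G}_{\rm m}$-derivation on $K$ is a sequence $D=(D_n:K\to K)_{n\in\mathbb{N}}$ of additive maps with $D_0=\mathrm{id}$, $D_n(xy)=\sum_{i+j=n}D_i(x)D_j(y)$ for all $n\in\mathbb{N}$ and $x,y\in K$, such that for all $r\in K$, in $K[[X,Y]]$, $$\sum_{i,j\ge0}D_i(D_j(r))X^iY^j=\sum_{n\ge0}D_n(r)(X+Y+XY)^n.$$ A $\mathbb{G}_{\rm m}[m]$-derivation on $K$ is a sequence $\partial=(\partial_n:K\to K)_{n<p^m}$ of additive maps with $\partial_0=\mathrm{id}$, $\partial_n(xy)=\sum_{i+j=n}\partial_i(x)\partial_j(y)$ for all $n<p^m$ and $x,y\in K$, such that for all $r\in K$, in $K[v,w]:=K[X,Y]/(X^{p^m},Y^{p^m})$ (with $v,w$ the classes of $X,Y$), $$\sum_{i,j<p^m}\partial_i(\partial_j(r))v^iw^j=\sum_{n<p^m}\partial_n(r)(v+w+vw)^n.$$ In both cases "over $M$" means that all terms with index $n>0$ vanish on $M$. *)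

theory Defs
  imports
    "HOL-Computational_Algebra.Computational_Algebra"
    "HOL-Library.Groups_Big_Fun"
begin

text \<open>
  The field \<open>K\<close> is a type \<open>'a\<close> of class \<^class>\<open>field\<close>; the subfield \<open>M\<close> is a set \<open>M :: 'a set\<close>.
\<close>

section \<open>Separable field extensions\<close>

definition is_subfield :: "'a::field set \<Rightarrow> bool" where
  "is_subfield F \<longleftrightarrow> 0 \<in> F \<and> 1 \<in> F \<and> (\<forall>x\<in>F. \<forall>y\<in>F. x - y \<in> F \<and> x * y \<in> F) \<and> (\<forall>x\<in>F. inverse x \<in> F)"

definition lin_indep_over :: "'a::field set \<Rightarrow> 'a set \<Rightarrow> bool" where
  "lin_indep_over F S \<longleftrightarrow>
     (\<forall>T c. finite T \<and> T \<subseteq> S \<and> c ` T \<subseteq> F \<and> (\<Sum>t\<in>T. c t * t) = 0 \<longrightarrow> (\<forall>t\<in>T. c t = 0))"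

definition linearly_disjoint_over :: "'a::field set \<Rightarrow> 'a set \<Rightarrow> 'a set \<Rightarrow> bool" where
  "linearly_disjoint_over F A B \<longleftrightarrow> (\<forall>S\<subseteq>A. lin_indep_over F S \<longrightarrow> lin_indep_over B S)"

text \<open>
  A not necessarily algebraic extension \<open>K\<close> of \<open>M\<close> in characteristic \<open>p > 0\<close> is separable if
  \<open>M\<close> and \<open>K\<^sup>p\<close> are linearly disjoint over \<open>M\<^sup>p\<close>; via the Frobenius map, this says that
  \<open>M\<^bsup>1/p\<^esup>\<close> and \<open>K\<close> are linearly disjoint over \<open>M\<close> (lemma \<open>separable_below_iff_roots\<close>).
\<close>

definition separable_below :: "'a::field set \<Rightarrow> bool" where
  "separable_below M \<longleftrightarrow>
     linearly_disjoint_over ((\<lambda>x. x ^ CHAR('a)) ` M) M (range (\<lambda>x. x ^ CHAR('a)))"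

lemma lin_indep_over_image:
  fixes h :: "'a::field \<Rightarrow> 'b::field"
  assumes inj: "inj h" and zero: "h 0 = 0"
    and add: "\<And>x y. h (x + y) = h x + h y" and mult: "\<And>x y. h (x * y) = h x * h y"
  shows "lin_indep_over (h ` F) (h ` S) \<longleftrightarrow> lin_indep_over F S"
proof
  have h_sum: "h (sum f T) = (\<Sum>t\<in>T. h (f t))" for f :: "'a \<Rightarrow> 'a" and T
    by (induction T rule: infinite_finite_induct) (simp_all add: zero add)
  have h_eq_0: "h x = 0 \<longleftrightarrow> x = 0" for x
    using inj zero by (metis injD)
  {
    assume indep: "lin_indep_over (h ` F) (h ` S)"
    show "lin_indep_over F S"
      unfolding lin_indep_over_def
    proof (intro allI impI, elim conjE)
      fix T c assume T: "finite T" "T \<subseteq> S" "c ` T \<subseteq> F" "(\<Sum>t\<in>T. c t * t) = 0"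
      define c' where "c' = (\<lambda>u. h (c (inv h u)))"
      have c': "c' (h t) = h (c t)" for t
        by (simp add: c'_def inv_f_f[OF inj])
      have "(\<Sum>u\<in>h ` T. c' u * u) = (\<Sum>t\<in>T. h (c t * t))"
        by (subst sum.reindex) (auto simp: c' mult intro: inj_on_subset[OF inj])
      also have "\<dots> = 0"
        using T(4) by (simp add: zero flip: h_sum)
      finally have "(\<Sum>u\<in>h ` T. c' u * u) = 0" .
      moreover have "finite (h ` T)" "h ` T \<subseteq> h ` S"
        using T(1,2) by (simp_all add: image_mono)
      moreover have "c' ` h ` T \<subseteq> h ` F"
        using T(3) by (simp add: image_image c' image_subset_iff)
      ultimately have "\<forall>u\<in>h ` T. c' u = 0"
        using indep unfolding lin_indep_over_def by blast
      then show "\<forall>t\<in>T. c t = 0"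
        by (simp add: c' h_eq_0)
    qed
  next
    assume indep: "lin_indep_over F S"
    show "lin_indep_over (h ` F) (h ` S)"
      unfolding lin_indep_over_def
    proof (intro allI impI, elim conjE)
      fix T c assume T: "finite T" "T \<subseteq> h ` S" "c ` T \<subseteq> h ` F" "(\<Sum>t\<in>T. c t * t) = 0"
      obtain U where U: "U \<subseteq> S" "finite U" "T = h ` U"
        using T(1,2) by (meson finite_subset_image)
      define c' where "c' = (\<lambda>u. inv h (c (h u)))"
      have c': "h (c' u) = c (h u)" if "u \<in> U" for u
        using that T(3) U(3) unfolding c'_def by (intro f_inv_into_f) blast
      have c'_F: "c' ` U \<subseteq> F"
      proof
        fix x assume "x \<in> c' ` U"
        then obtain u where "u \<in> U" "x = inv h (c (h u))" by (auto simp: c'_def)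
        moreover from this obtain a where "a \<in> F" "c (h u) = h a" using T(3) U(3) by blast
        ultimately show "x \<in> F" by (simp add: inv_f_f[OF inj])
      qed
      have "h (\<Sum>u\<in>U. c' u * u) = (\<Sum>u\<in>U. c (h u) * h u)"
        by (simp add: h_sum mult c')
      also have "\<dots> = 0"
        using T(4) unfolding U(3) by (subst (asm) sum.reindex) (auto intro: inj_on_subset[OF inj])
      finally have "\<forall>u\<in>U. c' u = 0"
        using indep U c'_F unfolding lin_indep_over_def by (simp add: h_eq_0)
      then show "\<forall>t\<in>T. c t = 0"
        using U(3) c' zero by (metis imageE)
    qed
  }
qed

lemma linearly_disjoint_over_image:
  fixes h :: "'a::field \<Rightarrow> 'b::field"
  assumes "inj h" "h 0 = 0"
    "\<And>x y. h (x + y) = h x + h y" "\<And>x y. h (x * y) = h x * h y"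
  shows "linearly_disjoint_over (h ` F) (h ` A) (h ` B) \<longleftrightarrow> linearly_disjoint_over F A B"
  unfolding linearly_disjoint_over_def all_subset_image lin_indep_over_image[OF assms] ..

lemma separable_below_iff_roots:
  fixes M :: "'a::field set" and h :: "'a \<Rightarrow> 'b::field"
  assumes p: "CHAR('a) = p" "CHAR('b) = p" "p > 0"
    and h: "inj h" "h 0 = 0" "\<And>x y. h (x + y) = h x + h y" "\<And>x y. h (x * y) = h x * h y"
    and roots: "\<And>x. x \<in> M \<Longrightarrow> \<exists>y. y ^ p = h x"
  shows "separable_below M \<longleftrightarrow> linearly_disjoint_over (h ` M) {y. y ^ p \<in> h ` M} (range h)"
proof -
  let ?Fr = "\<lambda>y::'b. y ^ p"
  have Fr: "?Fr (x + y) = ?Fr x + ?Fr y" "?Fr (x * y) = ?Fr x * ?Fr y" for x y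
    using p prime_CHAR_semidom[where ?'a = 'b] by (simp_all add: freshmans_dream power_mult_distrib)
  have Fr_inj: "inj ?Fr"
  proof (rule injI)
    fix x y :: 'b assume "x ^ p = y ^ p"
    moreover have "x ^ p = (x - y) ^ p + y ^ p"
      using Fr(1)[of "x - y" y] by simp
    ultimately show "x = y" by simp
  qed
  have h_1: "h 1 = 1"
    using h(1,2) h(4)[of 1 1] by (metis injD mult_cancel_right1 mult_1 zero_neq_one)
  have h_pow: "h (x ^ n) = h x ^ n" for x n
    by (induction n) (simp_all add: h_1 h(4))
  have "linearly_disjoint_over (h ` M) {y. y ^ p \<in> h ` M} (range h) \<longleftrightarrow>
      linearly_disjoint_over (?Fr ` h ` M) (?Fr ` {y. y ^ p \<in> h ` M}) (?Fr ` range h)"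
    by (rule linearly_disjoint_over_image[symmetric]) (use Fr Fr_inj p(3) in auto)
  also have "?Fr ` {y. y ^ p \<in> h ` M} = h ` M"
    using roots by (auto simp: image_iff) metis
  also have "?Fr ` h ` M = h ` (\<lambda>x. x ^ p) ` M"
    by (simp add: image_image h_pow)
  also have "?Fr ` range h = h ` range (\<lambda>x. x ^ p)"
    by (simp add: image_image h_pow)
  also have "linearly_disjoint_over (h ` (\<lambda>x. x ^ p) ` M) (h ` M) (h ` range (\<lambda>x. x ^ p)) \<longleftrightarrow>
      separable_below M"
    by (simp add: linearly_disjoint_over_image[OF h] separable_below_def p(1))
  finally show ?thesis ..
qed


section \<open>Power series in two variables\<close>

text \<open>
  \<open>K[[X,Y]]\<close> is \<open>K[[X]][[Y]]\<close>, so that \<open>f $ j $ i\<close> is the coefficient of \<open>X\<^sup>i Y\<^sup>j\<close>.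
  The topology of the type \<open>'a fps fps\<close> in the library is only the \<open>Y\<close>-adic one, for which
  \<open>\<Sum>n. c\<^sub>n (X + Y + XY)\<^sup>n\<close> need not converge. Infinite sums are therefore taken coefficientwise; this is
  meaningful for locally finite families, i.e. those in which each coefficient is non-zero
  for only finitely many members (\<^const>\<open>Sum_any\<close> is \<open>0\<close> on infinite supports).
  All families used below are locally finite, as shown at the end of this section.
\<close>

definition fps2_const :: "'a::comm_ring_1 \<Rightarrow> 'a fps fps" where
  "fps2_const c = fps_const (fps_const c)"

definition fps2_X :: "'a::comm_ring_1 fps fps" where
  "fps2_X = fps_const fps_X"

definition fps2_Y :: "'a::comm_ring_1 fps fps" where
  "fps2_Y = fps_X"

definition fps2_locally_finite :: "('i \<Rightarrow> 'a::comm_ring_1 fps fps) \<Rightarrow> bool" where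
  "fps2_locally_finite F \<longleftrightarrow> (\<forall>i j. finite {k. F k $ j $ i \<noteq> 0})"

definition fps2_sum :: "('i \<Rightarrow> 'a::comm_ring_1 fps fps) \<Rightarrow> 'a fps fps" where
  "fps2_sum F = Abs_fps (\<lambda>j. Abs_fps (\<lambda>i. Sum_any (\<lambda>k. F k $ j $ i)))"

lemma fps2_monomial_nth:
  "(fps2_const c * fps2_X ^ a * fps2_Y ^ b) $ j $ i = (if i = a \<and> j = b then c else 0)"
proof -
  have "fps2_const c * fps2_X ^ a * fps2_Y ^ b = fps_const (fps_const c * fps_X ^ a) * fps_X ^ b"
    by (simp add: fps2_const_def fps2_X_def fps2_Y_def fps_const_power)
  then show ?thesis by simp
qed

lemma fps2_const_mult_nth: "(fps2_const c * f) $ j $ i = c * f $ j $ i"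
  by (simp add: fps2_const_def)

lemma fps2_locally_finite_monomials:
  "fps2_locally_finite (\<lambda>(i, j). fps2_const (c i j) * fps2_X ^ i * fps2_Y ^ j)"
proof -
  have "finite {k. (case k of (a, b) \<Rightarrow> fps2_const (c a b) * fps2_X ^ a * fps2_Y ^ b) $ j $ i \<noteq> 0}"
    for i j
    by (rule finite_subset[of _ "{(i, j)}"]) (auto simp: fps2_monomial_nth split: if_splits)
  then show ?thesis by (simp add: fps2_locally_finite_def)
qed

lemma fps2_sum_monomials_nth:
  "fps2_sum (\<lambda>(i, j). fps2_const (c i j) * fps2_X ^ i * fps2_Y ^ j) $ j $ i = c i j"
proof -
  have "Sum_any (\<lambda>k. (case k of (a, b) \<Rightarrow> fps2_const (c a b) * fps2_X ^ a * fps2_Y ^ b) $ j $ i)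
      = (\<Sum>k\<in>{(i, j)}. (case k of (a, b) \<Rightarrow> fps2_const (c a b) * fps2_X ^ a * fps2_Y ^ b) $ j $ i)"
    by (rule Sum_any.expand_superset) (auto simp: fps2_monomial_nth split: if_splits)
  then show ?thesis by (simp add: fps2_sum_def fps2_monomial_nth)
qed

lemma fps2_group_law_power_nth:
  assumes "i + j < n"
  shows "((fps2_X + fps2_Y + fps2_X * fps2_Y :: 'a::comm_ring_1 fps fps) ^ n) $ j $ i = 0"
  using assms
proof (induction n arbitrary: i j)
  case (Suc n)
  let ?G = "fps2_X + fps2_Y + fps2_X * fps2_Y :: 'a fps fps"
  have "?G ^ Suc n = fps_const fps_X * ?G ^ n + fps_X * ?G ^ n + fps_X * (fps_const fps_X * ?G ^ n)"
    by (simp add: fps2_X_def fps2_Y_def algebra_simps)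
  then have "(?G ^ Suc n) $ j $ i =
      (if i = 0 then 0 else (?G ^ n) $ j $ (i - 1)) + (if j = 0 then 0 else (?G ^ n) $ (j - 1) $ i)
      + (if i = 0 \<or> j = 0 then 0 else (?G ^ n) $ (j - 1) $ (i - 1))"
    by (simp only:) simp
  also have "\<dots> = 0"
    using Suc by auto
  finally show ?case .
qed simp

lemma fps2_locally_finite_group_law:
  fixes c :: "nat \<Rightarrow> 'a::comm_ring_1"
  shows "fps2_locally_finite (\<lambda>n. fps2_const (c n) * (fps2_X + fps2_Y + fps2_X * fps2_Y) ^ n)"
proof -
  have "finite {n. (fps2_const (c n) * (fps2_X + fps2_Y + fps2_X * fps2_Y) ^ n) $ j $ i \<noteq> 0}" for i j
  proof (rule finite_subset)
    show "{n. (fps2_const (c n) * (fps2_X + fps2_Y + fps2_X * fps2_Y) ^ n) $ j $ i \<noteq> 0} \<subseteq> {..i + j}"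
    proof
      fix n assume "n \<in> {n. (fps2_const (c n) * (fps2_X + fps2_Y + fps2_X * fps2_Y) ^ n) $ j $ i \<noteq> 0}"
      then have "((fps2_X + fps2_Y + fps2_X * fps2_Y :: 'a fps fps) ^ n) $ j $ i \<noteq> 0"
        by (auto simp only: mem_Collect_eq fps2_const_mult_nth mult_zero_right)
      then show "n \<in> {..i + j}"
        using fps2_group_law_power_nth[of i j n] by (auto simp only: atMost_iff not_le[symmetric])
    qed
  qed simp
  then show ?thesis by (simp add: fps2_locally_finite_def)
qed


section \<open>Derivations of the multiplicative group and of its Frobenius kernels\<close>

definition Gm_derivation :: "(nat \<Rightarrow> 'a::field \<Rightarrow> 'a) \<Rightarrow> bool" where
  "Gm_derivation D \<longleftrightarrow>
     (\<forall>n x y. D n (x + y) = D n x + D n y) \<and>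
     D 0 = id \<and>
     (\<forall>n x y. D n (x * y) = (\<Sum>i\<le>n. D i x * D (n - i) y)) \<and>
     (\<forall>r. fps2_sum (\<lambda>(i, j). fps2_const (D i (D j r)) * fps2_X ^ i * fps2_Y ^ j)
        = fps2_sum (\<lambda>n. fps2_const (D n r) * (fps2_X + fps2_Y + fps2_X * fps2_Y) ^ n))"

text \<open>
  The polynomial ring \<open>K[X,Y]\<close> is \<open>K[X][Y]\<close>. An identity in \<open>K[X,Y]/(X\<^sup>q, Y\<^sup>q)\<close> is a congruence
  of representatives modulo the ideal \<open>(X\<^sup>q, Y\<^sup>q)\<close>.
\<close>

definition poly2_const :: "'a::comm_ring_1 \<Rightarrow> 'a poly poly" where
  "poly2_const c = [:[:c:]:]"

definition poly2_X :: "'a::comm_ring_1 poly poly" where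
  "poly2_X = [:[:0, 1:]:]"

definition poly2_Y :: "'a::comm_ring_1 poly poly" where
  "poly2_Y = [:0, 1:]"

definition poly2_cong :: "nat \<Rightarrow> 'a::comm_ring_1 poly poly \<Rightarrow> 'a poly poly \<Rightarrow> bool" where
  "poly2_cong q f g \<longleftrightarrow> (\<exists>a b. f - g = a * poly2_X ^ q + b * poly2_Y ^ q)"

text \<open>
  A \<open>\<bbbG>\<^sub>m[m]\<close>-derivation has only the terms with index below \<open>p\<^sup>m\<close>, where \<open>p\<close> is the characteristic.
  It is represented by a sequence indexed by all natural numbers whose values at
  indices \<open>\<ge> p\<^sup>m\<close> are irrelevant.
\<close>

definition Gm_trunc_derivation :: "nat \<Rightarrow> (nat \<Rightarrow> 'a::field \<Rightarrow> 'a) \<Rightarrow> bool" where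
  "Gm_trunc_derivation m d \<longleftrightarrow>
     (let q = CHAR('a) ^ m in
       (\<forall>n<q. \<forall>x y. d n (x + y) = d n x + d n y) \<and>
       d 0 = id \<and>
       (\<forall>n<q. \<forall>x y. d n (x * y) = (\<Sum>i\<le>n. d i x * d (n - i) y)) \<and>
       (\<forall>r. poly2_cong q
          (\<Sum>i<q. \<Sum>j<q. poly2_const (d i (d j r)) * poly2_X ^ i * poly2_Y ^ j)
          (\<Sum>n<q. poly2_const (d n r) * (poly2_X + poly2_Y + poly2_X * poly2_Y) ^ n)))"

end

theory Submission
  imports Defs
begin

text \<open>
  A \<open>\<bbbG>\<^sub>m[m]\<close>-derivation is a grading of \<open>K\<close> by \<open>\<int>/p\<^sup>m\<close>, in which \<open>\<partial>\<^sub>n\<close> multiplies an element of degree \<open>a\<close> by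
  the binomial coefficient \<open>a\<close> over \<open>n\<close>; a \<open>\<bbbG>\<^sub>m\<close>-derivation arises from gradings by \<open>\<int>/p\<^sup>i\<close> for all \<open>i\<close>, each
  refining the previous one. If the grading given by \<open>\<partial>\<close> is not trivial, its degrees form the subgroup
  generated by some \<open>p\<^sup>k\<close> with \<open>k < m\<close>, and \<open>K = C[t]\<close> for the field \<open>C\<close> of constants and an element \<open>t\<close> of
  degree \<open>p\<^sup>k\<close>, where \<open>c = t\<^sup>r\<close> with \<open>r = p\<^sup>m / p\<^sup>k\<close> lies in \<open>C\<close>. To refine it, one needs a subfield \<open>E\<close> of \<open>C\<close>
  over \<open>M\<close> such that the powers \<open>c\<^sup>j\<close> with \<open>j < p\<close> form an \<open>E\<close>-basis of \<open>C\<close>. The \<open>p\<close>-th root of \<open>c\<close> in \<open>K\<close> has nonzero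
  degree, so it is not in \<open>C\<close>, and by separability \<open>c\<close> is not in the compositum of \<open>M\<close> and \<open>C\<^sup>p\<close>. A subfield \<open>E\<close>
  of \<open>C\<close> that contains this compositum and is maximal with respect to \<open>c \<notin> E\<close> then works. The situation is
  reproduced with \<open>E\<close> and \<open>c\<^sup>p\<close> in place of \<open>C\<close> and \<open>c\<close>, so the construction can be iterated.
\<close>

section \<open>Linear independence and separability\<close>

lemma
  assumes "is_subfield F"
  shows subfield_zero: "0 \<in> F"
    and subfield_one: "1 \<in> F"
    and subfield_diff: "x \<in> F \<Longrightarrow> y \<in> F \<Longrightarrow> x - y \<in> F"
    and subfield_mult: "x \<in> F \<Longrightarrow> y \<in> F \<Longrightarrow> x * y \<in> F"
    and subfield_inverse: "x \<in> F \<Longrightarrow> inverse x \<in> F"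
  using assms by (auto simp: is_subfield_def)

lemma
  assumes F: "is_subfield F"
  shows subfield_uminus: "x \<in> F \<Longrightarrow> - x \<in> F"
    and subfield_add: "x \<in> F \<Longrightarrow> y \<in> F \<Longrightarrow> x + y \<in> F"
    and subfield_divide: "x \<in> F \<Longrightarrow> y \<in> F \<Longrightarrow> x / y \<in> F"
proof -
  have uminus: "- x \<in> F" if "x \<in> F" for x
    using subfield_diff[OF F subfield_zero[OF F] that] by simp
  then show "x \<in> F \<Longrightarrow> - x \<in> F" .
  show "x \<in> F \<Longrightarrow> y \<in> F \<Longrightarrow> x + y \<in> F"
    using subfield_diff[OF F, of x "- y"] uminus by simp
  show "x \<in> F \<Longrightarrow> y \<in> F \<Longrightarrow> x / y \<in> F"
    using subfield_mult[OF F _ subfield_inverse[OF F]] by (simp add: divide_inverse)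
qed

lemma subfield_sum: "is_subfield F \<Longrightarrow> (\<And>i. i \<in> I \<Longrightarrow> f i \<in> F) \<Longrightarrow> sum f I \<in> F"
  by (induction I rule: infinite_finite_induct) (auto intro: subfield_zero subfield_add)

lemma subfield_power: "is_subfield F \<Longrightarrow> x \<in> F \<Longrightarrow> x ^ n \<in> F"
  by (induction n) (auto intro: subfield_one subfield_mult)

lemma subfield_of_nat: "is_subfield F \<Longrightarrow> of_nat n \<in> F"
  by (induction n) (auto intro: subfield_zero subfield_one subfield_add)

lemma lin_indep_over_insert:
  assumes F: "is_subfield F" and T: "finite T" "lin_indep_over F T"
    and v: "\<nexists>c. range c \<subseteq> F \<and> v = (\<Sum>t\<in>T. c t * t)"
  shows "lin_indep_over F (insert v T)"
  unfolding lin_indep_over_def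
proof (intro allI impI, elim conjE)
  fix U c assume U: "finite U" "U \<subseteq> insert v T" "c ` U \<subseteq> F" "(\<Sum>t\<in>U. c t * t) = 0"
  let ?U = "U - {v}"
  have split: "c v * v + (\<Sum>t\<in>?U. c t * t) = 0" if "v \<in> U"
    using sum.remove[OF U(1) that, of "\<lambda>t. c t * t"] U(4) by simp
  have cv: "c v = 0" if "v \<in> U"
  proof (rule ccontr)
    assume nz: "c v \<noteq> 0"
    \<comment> \<open>The relation is solved for \<open>v\<close>. Coefficients outside
      \<open>?U\<close> are set to 0, so that the sum runs over all of \<open>T\<close> and
      contradicts the choice of \<open>v\<close> outside its span.\<close>
    define c' where "c' = (\<lambda>t. if t \<in> ?U then - (c t / c v) else 0)"
    have "range c' \<subseteq> F"
      using U(3) that by (auto simp: c'_def image_subset_iff intro!: subfield_uminus[OF F] subfield_divide[OF F] subfield_zero[OF F])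
    moreover have "(\<Sum>t\<in>T. c' t * t) = (\<Sum>t\<in>?U. c' t * t)"
      using T(1) U(2) by (intro sum.mono_neutral_right) (auto simp: c'_def)
    moreover have "\<dots> = - (\<Sum>t\<in>?U. c t * t) / c v"
      by (simp add: c'_def sum_divide_distrib sum_negf)
    moreover have "- (\<Sum>t\<in>?U. c t * t) = c v * v"
      using split[OF that] by (metis add.commute minus_unique)
    ultimately have "v = (\<Sum>t\<in>T. c' t * t)"
      using nz by simp
    with \<open>range c' \<subseteq> F\<close> show False using v by blast
  qed
  have "(\<Sum>t\<in>?U. c t * t) = 0"
    using split cv U(4) by (cases "v \<in> U") simp_all
  moreover have "finite ?U" using U(1) by simp
  moreover have "?U \<subseteq> T" using U(2) by blast
  moreover have "c ` ?U \<subseteq> F" using U(3) by blast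
  ultimately have "c t = 0" if "t \<in> ?U" for t
    using T(2)[unfolded lin_indep_over_def, rule_format, of ?U c t] that by simp
  then show "\<forall>t\<in>U. c t = 0" using cv by blast
qed

text \<open>Greedy extension: the elements of \<open>V\<close> are taken in turn, and each one
  outside the current span is added. Keeping \<open>T\<close> inside \<open>B\<close> matters in
  \<open>separable_belowD\<close>, where \<open>T = {1}\<close> makes 1 a basis element.\<close>

lemma lin_indep_over_extend:
  assumes F: "is_subfield F" and "finite V" "finite T" "lin_indep_over F T"
  shows "\<exists>B. finite B \<and> T \<subseteq> B \<and> B \<subseteq> T \<union> V \<and> lin_indep_over F B \<and>
    (\<forall>v\<in>V. \<exists>c. range c \<subseteq> F \<and> v = (\<Sum>t\<in>B. c t * t))"
  using assms(2)
proof (induction V rule: finite_induct)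
  case empty
  then show ?case using assms by auto
next
  case (insert v V)
  then obtain B where B: "finite B" "T \<subseteq> B" "B \<subseteq> T \<union> V" "lin_indep_over F B"
    "\<forall>v\<in>V. \<exists>c. range c \<subseteq> F \<and> v = (\<Sum>t\<in>B. c t * t)" by blast
  show ?case
  proof (cases "\<exists>c. range c \<subseteq> F \<and> v = (\<Sum>t\<in>B. c t * t)")
    case True
    then have "\<forall>w\<in>insert v V. \<exists>c. range c \<subseteq> F \<and> w = (\<Sum>t\<in>B. c t * t)"
      using B(5) by blast
    moreover have "B \<subseteq> T \<union> insert v V" using B(3) by auto
    ultimately show ?thesis using B(1,2,4) by blast
  next
    case False
    let ?B = "insert v B"
    have extend: "\<exists>c. range c \<subseteq> F \<and> w = (\<Sum>t\<in>?B. c t * t)"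
      if "range c \<subseteq> F" "w = (\<Sum>t\<in>B. c t * t)" "v \<notin> B" for w c
      using that B(1) subfield_zero[OF F] by (intro exI[of _ "c(v := 0)"]) (auto intro!: sum.cong)
    have "\<exists>c. range c \<subseteq> F \<and> v = (\<Sum>t\<in>?B. c t * t)"
    proof (intro exI[of _ "\<lambda>t. if t = v then 1 else 0"] conjI)
      show "v = (\<Sum>t\<in>?B. (if t = v then 1 else 0) * t)"
        using B(1) by (simp add: if_distrib[of "\<lambda>x. x * _"] cong: if_cong)
    qed (use subfield_zero[OF F] subfield_one[OF F] in auto)
    moreover have "\<exists>c. range c \<subseteq> F \<and> w = (\<Sum>t\<in>?B. c t * t)" if "w \<in> V" for w
      using B(5) that extend by (cases "v \<in> B") (auto simp: insert_absorb)
    ultimately have "\<forall>w\<in>insert v V. \<exists>c. range c \<subseteq> F \<and> w = (\<Sum>t\<in>?B. c t * t)"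
      by blast
    moreover have "T \<subseteq> ?B" "?B \<subseteq> T \<union> insert v V" using B(2,3) by auto
    ultimately show ?thesis
      using B(1) lin_indep_over_insert[OF F B(1,4) False] by (intro exI[of _ ?B]) simp
  qed
qed

section \<open>The Frobenius map and the use of separability\<close>

lemma power_char_diff:
  fixes x y :: "'a::comm_ring_1"
  assumes p: "prime p" "CHAR('a) = p"
  shows "(x - y) ^ p = x ^ p - y ^ p"
proof -
  have "(x - y + y) ^ p = (x - y) ^ p + y ^ p"
    by (rule freshmans_dream) (simp_all add: p)
  then show ?thesis by (simp add: algebra_simps)
qed

lemma subfield_frobenius_image:
  fixes F :: "'a::field set"
  assumes p: "prime p" "CHAR('a) = p" and F: "is_subfield F"
  shows "is_subfield ((\<lambda>x. x ^ p) ` F)"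
proof -
  note diff = power_char_diff[OF p, symmetric]
  have zero: "0 = (0::'a) ^ p" using p prime_gt_0_nat by (simp add: power_0_left)
  have one: "1 = (1::'a) ^ p" by simp
  show ?thesis
    unfolding is_subfield_def
  proof (intro conjI ballI)
    show "0 \<in> (\<lambda>x. x ^ p) ` F" using zero subfield_zero[OF F] by (rule image_eqI)
    show "1 \<in> (\<lambda>x. x ^ p) ` F" using one subfield_one[OF F] by (rule image_eqI)
  qed (auto simp: diff subfield_diff[OF F] subfield_mult[OF F] subfield_inverse[OF F]
    simp flip: power_mult_distrib power_inverse)
qed

text \<open>The \<open>m i\<close> are expanded, with p-th powers from \<open>M\<close> as
  coefficients, in a family \<open>B\<close> that contains 1. By separability \<open>B\<close> stays
  independent over all p-th powers of the field, so the coefficients of 1 in two expansions of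
  \<open>x ^ p\<close> can be compared: \<open>x ^ p = y 1 ^ p\<close>, hence
  \<open>x = y 1\<close>.\<close>

lemma separable_belowD:
  fixes M C :: "'a::field set"
  assumes p: "prime p" "CHAR('a) = p"
    and M: "is_subfield M" "separable_below M" and C: "is_subfield C" "M \<subseteq> C"
    and I: "finite I" and m: "\<And>i. i \<in> I \<Longrightarrow> m i \<in> M" and e: "\<And>i. i \<in> I \<Longrightarrow> e i \<in> C"
    and x: "x ^ p = (\<Sum>i\<in>I. m i * e i ^ p)"
  shows "x \<in> C"
proof -
  let ?Fr = "\<lambda>x::'a. x ^ p"
  have p0: "p > 0" using p prime_gt_0_nat by simp
  have Fsum: "(\<Sum>i\<in>A. f i) ^ p = (\<Sum>i\<in>A. f i ^ p)" for A and f :: "'b \<Rightarrow> 'a"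
    using p by (simp add: freshmans_dream_sum)
  note Fdiff = power_char_diff[OF p]
  note MF = subfield_frobenius_image[OF p M(1)]
  have "lin_indep_over (?Fr ` M) {1}"
    unfolding lin_indep_over_def by (auto simp: subset_singleton_iff)
  then obtain B where B: "finite B" "{1} \<subseteq> B" "B \<subseteq> {1} \<union> m ` I" "lin_indep_over (?Fr ` M) B"
    "\<forall>v\<in>m ` I. \<exists>c. range c \<subseteq> ?Fr ` M \<and> v = (\<Sum>t\<in>B. c t * t)"
    using lin_indep_over_extend[OF MF, of "m ` I" "{1}"] I by auto
  have "\<exists>b. range b \<subseteq> M \<and> m i = (\<Sum>t\<in>B. b t ^ p * t)" if "i \<in> I" for i
  proof -
    from B(5)[THEN bspec, OF imageI[OF that]]
    obtain c where c: "range c \<subseteq> ?Fr ` M" "m i = (\<Sum>t\<in>B. c t * t)" by (elim exE conjE)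
    have "c t \<in> ?Fr ` M" for t using c(1) by (rule subsetD) simp
    then have "\<forall>t. \<exists>b. b \<in> M \<and> c t = b ^ p" unfolding image_iff Bex_def by (intro allI)
    then obtain b where "\<forall>t. b t \<in> M \<and> c t = b t ^ p" by (rule choice[THEN exE])
    then show ?thesis using c(2) by (intro exI[of _ b] conjI) (simp_all add: image_subset_iff)
  qed
  then have "\<forall>i\<in>I. \<exists>b. range b \<subseteq> M \<and> m i = (\<Sum>t\<in>B. b t ^ p * t)" by simp
  from bchoice[OF this] obtain b where b: "\<And>i. i \<in> I \<Longrightarrow> range (b i) \<subseteq> M"
    "\<And>i. i \<in> I \<Longrightarrow> m i = (\<Sum>t\<in>B. b i t ^ p * t)" by blast
  \<comment> \<open>Since the Frobenius map is additive and multiplicative, the terms at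
    \<open>t\<close> add up to \<open>y t ^ p * t\<close>, with \<open>y t\<close> in
    \<open>C\<close>.\<close>
  define y where "y t = (\<Sum>i\<in>I. b i t * e i)" for t
  have "x ^ p = (\<Sum>i\<in>I. \<Sum>t\<in>B. b i t ^ p * t * e i ^ p)"
    unfolding x by (intro sum.cong refl) (simp add: b(2) sum_distrib_right)
  also have "\<dots> = (\<Sum>t\<in>B. \<Sum>i\<in>I. b i t ^ p * t * e i ^ p)"
    by (rule sum.swap)
  also have "\<dots> = (\<Sum>t\<in>B. y t ^ p * t)"
    by (simp add: y_def Fsum power_mult_distrib sum_distrib_left mult_ac)
  finally have xy: "x ^ p = (\<Sum>t\<in>B. y t ^ p * t)" .
  \<comment> \<open>\<open>z t ^ p\<close> is the difference between the coefficients of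
    \<open>t\<close> in the collected expansion and in the trivial one,
    \<open>x ^ p * 1\<close>.\<close>
  define z where "z t = y t - (if t = 1 then x else 0)" for t
  have "(\<Sum>t\<in>B. (if t = 1 then x ^ p else 0) * t) = (\<Sum>t\<in>B. if t = 1 then x ^ p else 0)"
    by (intro sum.cong) auto
  then have "(\<Sum>t\<in>B. (if t = 1 then x ^ p else 0) * t) = x ^ p"
    using B(1,2) by simp
  moreover have "z t ^ p = y t ^ p - (if t = 1 then x ^ p else 0)" for t
    using p0 by (simp add: z_def Fdiff)
  ultimately have z0: "(\<Sum>t\<in>B. z t ^ p * t) = 0"
    using xy by (simp add: left_diff_distrib sum_subtractf)
  have "B \<subseteq> M" using B(3) m subfield_one[OF M(1)] by blast
  then have li: "lin_indep_over (range ?Fr) B"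
    using M(2) B(4) p(2) unfolding separable_below_def linearly_disjoint_over_def by simp
  have img: "(\<lambda>t. z t ^ p) ` B \<subseteq> range ?Fr"
    by (rule image_subsetI) (rule rangeI)
  have "z t ^ p = 0" if "t \<in> B" for t
    using li[unfolded lin_indep_over_def, rule_format,
      OF conjI[OF B(1) conjI[OF subset_refl conjI[OF img z0]]] that] .
  then have "z 1 ^ p = 0" using B(2) by simp
  then have "z 1 = 0" using p0 by simp
  then have "x = y 1" by (simp add: z_def)
  also have "y 1 \<in> C"
    unfolding y_def
  proof (intro subfield_sum[OF C(1)] subfield_mult[OF C(1)])
    fix i assume "i \<in> I"
    then show "b i 1 \<in> C" "e i \<in> C" using b(1) C(2) e by blast+
  qed
  finally show ?thesis .
qed
section \<open>Purely inseparable simple extensions\<close>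

lemma coeff_mult_subfield:
  assumes "is_subfield F" "range (coeff f) \<subseteq> F" "range (coeff g) \<subseteq> F"
  shows "range (coeff (f * g)) \<subseteq> F"
  using assms by (auto simp: coeff_mult intro!: subfield_sum subfield_mult)

lemma coeff_diff_subfield:
  assumes "is_subfield F" "range (coeff f) \<subseteq> F" "range (coeff g) \<subseteq> F"
  shows "range (coeff (f - g)) \<subseteq> F"
  using assms by (auto intro!: subfield_diff)

lemma coeff_monom_subfield: "is_subfield F \<Longrightarrow> c \<in> F \<Longrightarrow> range (coeff (monom c n)) \<subseteq> F"
  by (auto simp: subfield_zero)

text \<open>Long division divides only by the leading coefficient of \<open>g\<close>, so it never
  leaves \<open>F\<close>. Divisibility is meant over the whole field; only the remainder is tracked
  in \<open>F\<close>.\<close>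

lemma poly_division_subfield:
  fixes f g :: "'a::field poly"
  assumes F: "is_subfield F" and f: "range (coeff f) \<subseteq> F" and g: "range (coeff g) \<subseteq> F" "g \<noteq> 0"
  shows "\<exists>r. range (coeff r) \<subseteq> F \<and> g dvd f - r \<and> (r = 0 \<or> degree r < degree g)"
  using f
proof (induction "degree f" arbitrary: f rule: less_induct)
  case less
  show ?case
  proof (cases "f = 0 \<or> degree f < degree g")
    case True
    then show ?thesis using less.prems by (intro exI[of _ f]) auto
  next
    case False
    define h where "h = monom (lead_coeff f / lead_coeff g) (degree f - degree g)"
    have h: "range (coeff h) \<subseteq> F"
      unfolding h_def using less.prems g by (intro coeff_monom_subfield subfield_divide F) auto
    have deg: "degree (h * g) = degree f"
      using False g by (simp add: h_def degree_mult_eq degree_monom_eq)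
    have "coeff (h * g) (degree f) = lead_coeff h * lead_coeff g"
      using deg by (metis lead_coeff_mult)
    then have lc: "coeff (f - h * g) (degree f) = 0"
      using False g by (simp add: h_def degree_monom_eq)
    have hg: "range (coeff (f - h * g)) \<subseteq> F"
      by (intro coeff_diff_subfield coeff_mult_subfield F h g less.prems)
    show ?thesis
    proof (cases "f - h * g = 0")
      case True
      then show ?thesis using subfield_zero[OF F] by (intro exI[of _ 0]) auto
    next
      case nz: False
      have "degree (f - h * g) \<le> degree f" using deg by (metis degree_diff_le order_refl)
      moreover have "degree (f - h * g) \<noteq> degree f" using nz lc by (metis leading_coeff_0_iff)
      ultimately have "degree (f - h * g) < degree f" by simp
      from less.hyps[OF this hg] obtain r where
        r: "range (coeff r) \<subseteq> F" "g dvd f - h * g - r" "r = 0 \<or> degree r < degree g" by blast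
      then have "g dvd (f - h * g - r) + h * g" by (intro dvd_add) auto
      then have "g dvd f - r" by (simp add: algebra_simps)
      then show ?thesis using r by blast
    qed
  qed
qed

lemma linear_poly_power_char:
  fixes x :: "'a::field"
  assumes p: "prime p" "CHAR('a) = p"
  shows "[:-x, 1:] ^ p = monom 1 p - monom (x ^ p) 0"
proof -
  have "monom 1 p = ([:-x, 1:] + monom x 0) ^ p"
    by (simp add: monom_0 monom_altdef)
  also have "\<dots> = [:-x, 1:] ^ p + monom (x ^ p) 0"
    using p by (subst freshmans_dream) (simp_all add: monom_power)
  finally show ?thesis by simp
qed

text \<open>The multiplicities of the root \<open>x\<close> in \<open>g\<close> and in its cofactor
  add up to \<open>n\<close>, so what remains of the two factors multiplies to 1 and is
  constant.\<close>

lemma dvd_linear_poly_power: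
  fixes x :: "'a::field"
  assumes "g dvd [:-x, 1:] ^ n"
  shows "\<exists>c. g = smult c ([:-x, 1:] ^ degree g)"
proof -
  obtain h where h: "[:-x, 1:] ^ n = g * h" using assms by (auto elim: dvdE)
  have nz: "g * h \<noteq> 0" by (metis h power_eq_0_iff one_neq_zero pCons_eq_0_iff)
  then obtain g' h' where g': "g = [:-x, 1:] ^ order x g * g'" and h': "h = [:-x, 1:] ^ order x h * h'"
    by (metis mult_eq_0_iff order_decomp)
  have n: "n = order x g + order x h"
    using order_mult[OF nz] order_power_n_n[of x n] h by simp
  have "g * h = ([:-x, 1:] ^ order x g * g') * ([:-x, 1:] ^ order x h * h')"
    by (rule arg_cong2[where f = "(*)", OF g' h'])
  then have "[:-x, 1:] ^ n * (g' * h') = g * h"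
    by (simp only: n power_add mult_ac)
  then have "[:-x, 1:] ^ n * (g' * h') = [:-x, 1:] ^ n * 1"
    using h by simp
  then have "g' * h' = 1"
    unfolding h mult_left_cancel[OF nz] .
  then have "is_unit g'" by (metis dvd_triv_left)
  then obtain c where "g' = [:c:]" "c dvd 1" by (auto simp: is_unit_poly_iff)
  then have c: "g' = [:c:]" "c \<noteq> 0" by auto
  have gc: "g = smult c ([:-x, 1:] ^ order x g)" using g' c(1) by simp
  then have "degree g = order x g" using c(2) by (metis degree_smult_eq degree_linear_power)
  then show ?thesis using gc by auto
qed

text \<open>A nonzero polynomial \<open>g\<close> over \<open>F\<close> of least degree
  \<open>n\<close> that vanishes at \<open>x\<close> divides \<open>X^p - x^p = (X - x)^p\<close>,
  so it equals \<open>c (X - x)^n\<close> with \<open>0 < n < p\<close>. Its coefficient at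
  \<open>n - 1\<close> is \<open>- c n x\<close>, and \<open>n\<close> is invertible, which would
  put \<open>x\<close> into \<open>F\<close>.\<close>

lemma purely_inseparable_independent:
  fixes F :: "'a::field set"
  assumes p: "prime p" "CHAR('a) = p" and F: "is_subfield F" and x: "x ^ p \<in> F" "x \<notin> F"
    and f: "range (coeff f) \<subseteq> F" "degree f < p" "poly f x = 0"
  shows "f = 0"
proof (rule ccontr)
  assume "f \<noteq> 0"
  let ?P = "\<lambda>g. g \<noteq> 0 \<and> range (coeff g) \<subseteq> F \<and> poly g x = 0"
  obtain g where g: "?P g" and min: "\<And>h. ?P h \<Longrightarrow> degree g \<le> degree h"
    using ex_has_least_nat[of ?P f degree] \<open>f \<noteq> 0\<close> f by blast
  have "degree g < p" using min[of f] f \<open>f \<noteq> 0\<close> by simp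
  let ?X = "[:-x, 1:] ^ p"
  have "range (coeff ?X) \<subseteq> F"
    unfolding linear_poly_power_char[OF p]
    using x(1) subfield_one[OF F] by (simp only: coeff_diff_subfield[OF F] coeff_monom_subfield[OF F])
  then obtain r where r: "range (coeff r) \<subseteq> F" "g dvd ?X - r" "r = 0 \<or> degree r < degree g"
    using poly_division_subfield[OF F, of ?X g] g by auto
  have "p > 0" using p prime_gt_0_nat by blast
  obtain k where "?X - r = g * k" using r(2) by (rule dvdE)
  then have "poly (?X - r) x = 0" using g by simp
  then have rx: "poly r x = 0" using \<open>p > 0\<close> by (simp add: power_0_left)
  have r0: "r = 0"
  proof (rule ccontr)
    assume "r \<noteq> 0"
    then have "degree g \<le> degree r" using min[of r] r(1) rx by blast
    then show False using r(3) \<open>r \<noteq> 0\<close> by simp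
  qed
  obtain c where c: "g = smult c ([:-x, 1:] ^ degree g)"
    using dvd_linear_poly_power[of g x p] r(2) unfolding r0 by auto
  define n where "n = degree g"
  have n: "n > 0"
  proof (rule ccontr)
    assume "\<not> n > 0"
    then obtain a where "g = [:a:]" unfolding n_def by (metis degree_eq_zeroE gr0I)
    then show False using g by auto
  qed
  have "c \<noteq> 0" using c g by auto
  have "coeff g n = c" unfolding n_def by (subst c) (simp add: coeff_linear_power)
  then have "c \<in> F" using g by auto
  have "coeff g (n - 1) = - (c * of_nat n * x)"
    using n binomial_symmetric[of 1 n] by (subst c) (simp add: coeff_linear_poly_power flip: n_def)
  moreover have nz: "(of_nat n :: 'a) \<noteq> 0"
    using n \<open>degree g < p\<close> p(2) by (auto simp: of_nat_eq_0_iff_char_dvd n_def dest: dvd_imp_le)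
  ultimately have "x = - coeff g (n - 1) / (c * of_nat n)"
    using \<open>c \<noteq> 0\<close> by (simp add: field_simps)
  also have "\<dots> \<in> F"
    using g \<open>c \<in> F\<close> by (intro subfield_divide subfield_uminus subfield_mult subfield_of_nat F) auto
  finally show False using x by simp
qed

text \<open>Closing a subset of \<open>C\<close> that contains \<open>C\<^sup>p\<close> under inverses costs nothing, as \<open>1/x = x\<^bsup>p-1\<^esup> (1/x)\<^sup>p\<close>.\<close>

lemma subfield_between_frobenius:
  assumes C: "is_subfield C" and S: "S \<subseteq> C" "1 \<in> S" and p: "p > 0"
    and diff: "\<And>x y. x \<in> S \<Longrightarrow> y \<in> S \<Longrightarrow> x - y \<in> S"
    and mult: "\<And>x y. x \<in> S \<Longrightarrow> y \<in> S \<Longrightarrow> x * y \<in> S"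
    and frob: "\<And>x. x \<in> C \<Longrightarrow> x ^ p \<in> S"
  shows "is_subfield S"
proof -
  have "0 \<in> S" using diff[OF S(2) S(2)] by simp
  have pow: "x ^ n \<in> S" if "x \<in> S" for x n
    using that by (induction n) (auto intro: S mult)
  have "inverse x \<in> S" if "x \<in> S" for x
  proof (cases "x = 0")
    case False
    have "x ^ (p - 1) * inverse x ^ p \<in> S"
      using that S(1) by (intro mult pow frob subfield_inverse[OF C]) auto
    moreover have "x ^ (p - 1) * inverse x ^ p = inverse x"
      using False p by (cases p) (simp_all add: field_simps)
    ultimately show ?thesis by simp
  qed (use \<open>0 \<in> S\<close> in simp)
  then show ?thesis
    using \<open>0 \<in> S\<close> S(2) diff mult by (simp add: is_subfield_def)
qed

section \<open>The compositum with the p-th powers, and adjunction of one element\<close>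

inductive_set products_span :: "'a::comm_ring_1 set \<Rightarrow> 'a set \<Rightarrow> 'a set" for A B where
  zero: "0 \<in> products_span A B"
| step: "a \<in> A \<Longrightarrow> b \<in> B \<Longrightarrow> y \<in> products_span A B \<Longrightarrow> a * b + y \<in> products_span A B"

lemma products_span_product: "a \<in> A \<Longrightarrow> b \<in> B \<Longrightarrow> a * b \<in> products_span A B"
  using products_span.step[OF _ _ products_span.zero] by fastforce

lemma products_span_add:
  assumes "x \<in> products_span A B" "y \<in> products_span A B"
  shows "x + y \<in> products_span A B"
  using assms by (induction x rule: products_span.induct) (auto simp: add.assoc intro: products_span.step)

lemma products_span_uminus:
  assumes "x \<in> products_span A B" and "\<And>a. a \<in> A \<Longrightarrow> - a \<in> A"
  shows "- x \<in> products_span A B"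
  using assms(1)
proof (induction x rule: products_span.induct)
  case (step a b y)
  then have "(- a) * b + (- y) \<in> products_span A B"
    by (intro products_span.step assms(2))
  then show ?case by (simp add: algebra_simps)
qed (simp add: products_span.zero)

lemma products_span_mult:
  assumes "x \<in> products_span A B" "y \<in> products_span A B"
    and A: "\<And>a a'. a \<in> A \<Longrightarrow> a' \<in> A \<Longrightarrow> a * a' \<in> A" and B: "\<And>b b'. b \<in> B \<Longrightarrow> b' \<in> B \<Longrightarrow> b * b' \<in> B"
  shows "x * y \<in> products_span A B"
  using assms(1)
proof (induction x rule: products_span.induct)
  case (step a b x)
  have "(a * b) * y \<in> products_span A B"
    using assms(2)
  proof (induction y rule: products_span.induct)
    case (step a' b' y)
    have "(a * a') * (b * b') + a * b * y \<in> products_span A B"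
      by (intro products_span.step A B \<open>a \<in> A\<close> \<open>b \<in> B\<close> step)
    then show ?case by (simp add: algebra_simps)
  qed (simp add: products_span.zero)
  then have "a * b * y + x * y \<in> products_span A B"
    using step.IH by (rule products_span_add)
  then show ?case by (simp add: algebra_simps)
qed (simp add: products_span.zero)

lemma products_span_sum:
  assumes "x \<in> products_span A B"
  shows "\<exists>(n::nat) a b. (\<forall>i<n. a i \<in> A \<and> b i \<in> B) \<and> x = (\<Sum>i<n. a i * b i)"
  using assms
proof (induction x rule: products_span.induct)
  case zero
  show ?case by (intro exI[of _ 0]) simp
next
  case (step c d y)
  then obtain n :: nat and a b where ab: "\<forall>i<n. a i \<in> A \<and> b i \<in> B" "y = (\<Sum>i<n. a i * b i)" by blast
  let ?a = "a(n := c)" and ?b = "b(n := d)"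
  have "\<forall>i<Suc n. ?a i \<in> A \<and> ?b i \<in> B" using ab(1) step(1,2) by (simp add: less_Suc_eq)
  moreover have "c * d + y = (\<Sum>i<Suc n. ?a i * ?b i)" using ab(2) by simp
  ultimately show ?case by blast
qed

lemma products_span_subset:
  assumes C: "is_subfield C" and "A \<subseteq> C" "B \<subseteq> C"
  shows "products_span A B \<subseteq> C"
proof
  fix x assume "x \<in> products_span A B"
  then show "x \<in> C"
    by (induction x rule: products_span.induct)
      (use assms in \<open>auto intro!: subfield_zero[OF C] subfield_add[OF C] subfield_mult[OF C]\<close>)
qed

text \<open>This is the ring \<open>E[x]\<close>. By \<open>adjoin_subfield\<close> it is already a
  field when \<open>E\<close> contains the p-th powers of a larger field containing
  \<open>x\<close>.\<close>

definition adjoin :: "'a::field set \<Rightarrow> 'a \<Rightarrow> 'a set" where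
  "adjoin E x = (\<lambda>g. poly g x) ` {g. range (coeff g) \<subseteq> E}"

lemma adjoinI: "range (coeff g) \<subseteq> E \<Longrightarrow> poly g x \<in> adjoin E x"
  by (auto simp: adjoin_def)

lemma adjoin_base: assumes "is_subfield E" shows "E \<subseteq> adjoin E x"
proof
  fix e assume "e \<in> E"
  then have "poly (monom e 0) x \<in> adjoin E x" by (intro adjoinI coeff_monom_subfield assms)
  then show "e \<in> adjoin E x" by (simp add: poly_monom)
qed

lemma adjoin_generator: assumes "is_subfield E" shows "x \<in> adjoin E x"
proof -
  have "poly (monom 1 1) x \<in> adjoin E x" by (intro adjoinI coeff_monom_subfield assms subfield_one)
  then show ?thesis by (simp add: poly_monom)
qed

lemma adjoin_subset:
  assumes C: "is_subfield C" "E \<subseteq> C" "x \<in> C"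
  shows "adjoin E x \<subseteq> C"
proof
  fix y assume "y \<in> adjoin E x"
  then obtain g where g: "range (coeff g) \<subseteq> E" "y = poly g x" by (auto simp: adjoin_def)
  have "coeff g i \<in> C" for i using g(1) C(2) by blast
  then show "y \<in> C"
    unfolding g(2) poly_altdef by (intro subfield_sum[OF C(1)] subfield_mult[OF C(1)] subfield_power[OF C(1)] C(3))
qed

lemma adjoin_subfield:
  assumes C: "is_subfield C" and E: "is_subfield E" "E \<subseteq> C" and x: "x \<in> C" and p: "p > 0"
    and frob: "\<And>x. x \<in> C \<Longrightarrow> x ^ p \<in> E"
  shows "is_subfield (adjoin E x)"
proof (rule subfield_between_frobenius[OF C adjoin_subset[OF C E(2) x] _ p])
  show "1 \<in> adjoin E x" using adjoin_base[OF E(1)] subfield_one[OF E(1)] by blast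
  show "y ^ p \<in> adjoin E x" if "y \<in> C" for y using adjoin_base[OF E(1)] frob[OF that] by blast
  fix y z assume "y \<in> adjoin E x" "z \<in> adjoin E x"
  then obtain g h where g: "range (coeff g) \<subseteq> E" "y = poly g x" and h: "range (coeff h) \<subseteq> E" "z = poly h x"
    unfolding adjoin_def by blast
  show "y - z \<in> adjoin E x"
    using adjoinI[OF coeff_diff_subfield[OF E(1) g(1) h(1)], of x] g(2) h(2) by simp
  show "y * z \<in> adjoin E x"
    using adjoinI[OF coeff_mult_subfield[OF E(1) g(1) h(1)], of x] g(2) h(2) by simp
qed

text \<open>Reduction modulo \<open>X^p - x^p\<close>, a polynomial over \<open>E\<close> of degree
  \<open>p\<close> that vanishes at \<open>x\<close>.\<close>

lemma adjoin_degree_less: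
  assumes E: "is_subfield E" and x: "x ^ p \<in> E" and p: "p > 0" and y: "y \<in> adjoin E x"
  shows "\<exists>r. range (coeff r) \<subseteq> E \<and> degree r < p \<and> y = poly r x"
proof -
  let ?X = "monom 1 p - monom (x ^ p) 0"
  obtain g where g: "range (coeff g) \<subseteq> E" "y = poly g x" using y unfolding adjoin_def by blast
  have X: "range (coeff ?X) \<subseteq> E"
    by (intro coeff_diff_subfield coeff_monom_subfield E x subfield_one)
  have deg: "degree ?X = p"
  proof -
    have "degree (monom (x ^ p) 0) < degree (monom (1::'a) p)"
      using p by (simp add: degree_monom_eq monom_0)
    then have "degree (- monom (x ^ p) 0 + monom (1::'a) p) = degree (monom (1::'a) p)"
      by (intro degree_add_eq_right) simp
    then show ?thesis by (simp add: degree_monom_eq)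
  qed
  then have "?X \<noteq> 0" using p by (metis degree_0 less_irrefl)
  then obtain r where r: "range (coeff r) \<subseteq> E" "?X dvd g - r" "r = 0 \<or> degree r < degree ?X"
    using poly_division_subfield[OF E g(1) X] by auto
  obtain k where "g - r = ?X * k" using r(2) by (rule dvdE)
  then have "poly (g - r) x = 0" by (simp add: poly_monom)
  then have "y = poly r x" using g(2) by simp
  moreover have "degree r < p" using r(3) deg p by auto
  ultimately show ?thesis using r(1) by blast
qed

section \<open>Power bases\<close>

text \<open>Combinations are indexed by exponents and not by elements, so over a subfield
  \<open>F\<close> independence also makes the powers of \<open>t\<close> below \<open>L\<close>
  distinct.\<close>

definition power_basis :: "'a::field set \<Rightarrow> 'a set \<Rightarrow> nat \<Rightarrow> 'a \<Rightarrow> bool" where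
  "power_basis F C L t \<longleftrightarrow>
     (\<forall>x\<in>C. \<exists>f. (\<forall>b. f b \<in> F) \<and> x = (\<Sum>b<L. f b * t ^ b)) \<and>
     (\<forall>f. (\<forall>b. f b \<in> F) \<and> (\<Sum>b<L. f b * t ^ b) = 0 \<longrightarrow> (\<forall>b<L. f b = 0))"

lemma chain_Union_subfield:
  assumes "\<C> \<noteq> {}" "subset.chain \<A> \<C>" and sub: "\<And>E. E \<in> \<A> \<Longrightarrow> is_subfield E"
  shows "is_subfield (\<Union>\<C>)"
proof -
  have E: "is_subfield E" if "E \<in> \<C>" for E
    using assms(2) that sub unfolding subset.chain_def by blast
  obtain E0 where E0: "E0 \<in> \<C>" using assms(1) by blast
  have two: "\<exists>E\<in>\<C>. x \<in> E \<and> y \<in> E" if "x \<in> \<Union>\<C>" "y \<in> \<Union>\<C>" for x y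
    using assms(2) that unfolding subset_chain_def by blast
  show ?thesis
    unfolding is_subfield_def
  proof (intro conjI ballI)
    show "0 \<in> \<Union>\<C>" "1 \<in> \<Union>\<C>" using E0 subfield_zero[OF E] subfield_one[OF E] by blast+
    fix x assume x: "x \<in> \<Union>\<C>"
    then show "inverse x \<in> \<Union>\<C>" using subfield_inverse[OF E] by blast
    fix y assume y: "y \<in> \<Union>\<C>"
    obtain X where X: "X \<in> \<C>" "x \<in> X" "y \<in> X" using two[OF x y] by blast
    show "x - y \<in> \<Union>\<C>" by (rule UnionI[OF X(1) subfield_diff[OF E[OF X(1)] X(2,3)]])
    show "x * y \<in> \<Union>\<C>" by (rule UnionI[OF X(1) subfield_mult[OF E[OF X(1)] X(2,3)]])
  qed
qed

text \<open>Suppose \<open>y\<close> in \<open>C\<close> is outside \<open>E[c]\<close>. By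
  maximality \<open>c\<close> lies in \<open>E[y]\<close>, so \<open>c = r(y)\<close> with
  \<open>r\<close> over \<open>E\<close> of degree below \<open>p\<close>. Then \<open>r - c\<close>
  is a relation of degree below \<open>p\<close> for \<open>y\<close> over \<open>E[c]\<close>,
  hence zero, and \<open>c\<close> is the constant coefficient of \<open>r\<close>, which lies in
  \<open>E\<close>.\<close>

lemma simple_extension_power_basis:
  fixes E C :: "'a::field set"
  assumes p: "prime p" "CHAR('a) = p" and C: "is_subfield C"
    and E: "is_subfield E" "E \<subseteq> C" and frob: "\<And>x. x \<in> C \<Longrightarrow> x ^ p \<in> E"
    and c: "c \<in> C" "c \<notin> E"
    and max: "\<And>E'. is_subfield E' \<Longrightarrow> E \<subseteq> E' \<Longrightarrow> E' \<subseteq> C \<Longrightarrow> c \<notin> E' \<Longrightarrow> E' = E"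
  shows "power_basis E C p c"
proof -
  have p0: "p > 0" using p prime_gt_0_nat by blast
  let ?Ec = "adjoin E c"
  have Ec: "is_subfield ?Ec" by (rule adjoin_subfield[OF C E c(1) p0 frob])
  have gen: "y \<in> ?Ec" if y: "y \<in> C" for y
  proof (rule ccontr)
    assume y': "y \<notin> ?Ec"
    then have "y \<notin> E" using adjoin_base[OF E(1)] by blast
    then have "adjoin E y \<noteq> E" using adjoin_generator[OF E(1)] by blast
    then have "c \<in> adjoin E y"
      using max[OF adjoin_subfield[OF C E y p0 frob] adjoin_base[OF E(1)] adjoin_subset[OF C E(2) y]]
      by blast
    then obtain r where r: "range (coeff r) \<subseteq> E" "degree r < p" "c = poly r y"
      using adjoin_degree_less[OF E(1) frob[OF y] p0] by blast
    let ?f = "r - monom c 0"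
    have "range (coeff r) \<subseteq> ?Ec" using r(1) adjoin_base[OF E(1)] by blast
    then have f: "range (coeff ?f) \<subseteq> ?Ec"
      using adjoin_generator[OF E(1)] by (intro coeff_diff_subfield coeff_monom_subfield Ec)
    have "degree ?f < p" using r(2) p0 by (intro degree_diff_less) (simp_all add: monom_0)
    moreover have "poly ?f y = 0" using r(3) by (simp add: poly_monom)
    moreover have "y ^ p \<in> ?Ec" using frob[OF y] adjoin_base[OF E(1)] by blast
    ultimately have "?f = 0"
      using purely_inseparable_independent[OF p Ec _ y' f] by blast
    then have "coeff r 0 = c" by simp
    then show False using r(1) c(2) by blast
  qed
  show ?thesis
    unfolding power_basis_def
  proof (intro conjI ballI allI impI; (elim conjE)?)
    fix x assume "x \<in> C"
    then obtain r where r: "range (coeff r) \<subseteq> E" "degree r < p" "x = poly r c"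
      using adjoin_degree_less[OF E(1) frob[OF c(1)] p0] gen by blast
    have "poly r c = (\<Sum>b<p. coeff r b * c ^ b)"
      unfolding poly_altdef using r(2) by (intro sum.mono_neutral_left) (auto simp: coeff_eq_0)
    then show "\<exists>f. (\<forall>b. f b \<in> E) \<and> x = (\<Sum>b<p. f b * c ^ b)"
      using r(1,3) by (intro exI[of _ "coeff r"]) (simp add: image_subset_iff)
  next
    fix f b assume f: "\<forall>b. f b \<in> E" "(\<Sum>b<p. f b * c ^ b) = 0" and b: "b < p"
    define g where "g = (\<Sum>b<p. monom (f b) b)"
    have co: "coeff g i = (if i < p then f i else 0)" for i
      by (simp add: g_def coeff_sum)
    have "degree g \<le> p - 1" by (rule degree_le) (auto simp: co)
    then have "degree g < p" using p0 by simp
    moreover have "poly g c = 0" using f(2) by (simp add: g_def poly_sum poly_monom)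
    moreover have "range (coeff g) \<subseteq> E" using f(1) subfield_zero[OF E(1)] by (auto simp: co)
    ultimately have "g = 0"
      using purely_inseparable_independent[OF p E(1) frob[OF c(1)] c(2)] by blast
    then show "f b = 0" using co[of b] b by simp
  qed
qed

text \<open>
  Separability enters here only: it keeps \<open>x\<^sup>p\<close> out of the compositum of \<open>M\<close> and \<open>C\<^sup>p\<close>, above which
  a subfield maximal with respect to not containing \<open>x\<^sup>p\<close> is chosen.
\<close>

lemma exists_subfield_power_basis:
  fixes M C :: "'a::field set"
  assumes p: "prime p" "CHAR('a) = p"
    and M: "is_subfield M" "separable_below M" and C: "is_subfield C" "M \<subseteq> C"
    and x: "x \<notin> C" "x ^ p \<in> C"
  shows "\<exists>E. is_subfield E \<and> M \<subseteq> E \<and> E \<subseteq> C \<and> x ^ p \<notin> E \<and> (x ^ p) ^ p \<in> E \<and> power_basis E C p (x ^ p)"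
proof -
  have p0: "p > 0" using p prime_gt_0_nat by blast
  let ?Fr = "\<lambda>x. x ^ p"
  \<comment> \<open>For subfields, the additive span of products is the ring generated by both. As
    it contains the p-th powers of \<open>C\<close>, it is the compositum.\<close>
  define A where "A = products_span M (?Fr ` C)"
  have FrC: "is_subfield (?Fr ` C)" by (rule subfield_frobenius_image[OF p C(1)])
  have one: "1 \<in> ?Fr ` C" using subfield_one[OF FrC] .
  have AC: "A \<subseteq> C"
    unfolding A_def using subfield_power[OF C(1)] by (intro products_span_subset C) auto
  have MA: "M \<subseteq> A" unfolding A_def using products_span_product[OF _ one, of _ M] by auto
  have frobA: "y ^ p \<in> A" if "y \<in> C" for y
    unfolding A_def using products_span_product[OF subfield_one[OF M(1)], of "y ^ p" "?Fr ` C"] that by simp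
  have A: "is_subfield A"
  proof (rule subfield_between_frobenius[OF C(1) AC _ p0 _ _ frobA])
    show "1 \<in> A" using MA subfield_one[OF M(1)] by blast
    fix y z assume yz: "y \<in> A" "z \<in> A"
    show "y * z \<in> A"
      using yz unfolding A_def
      by (rule products_span_mult[OF _ _ subfield_mult[OF M(1)] subfield_mult[OF FrC]])
    have "- z \<in> A"
      using yz(2) unfolding A_def by (rule products_span_uminus[OF _ subfield_uminus[OF M(1)]])
    with yz(1) have "y + - z \<in> A" unfolding A_def by (rule products_span_add)
    then show "y - z \<in> A" by simp
  qed
  have cA: "x ^ p \<notin> A"
  proof
    assume "x ^ p \<in> A"
    from products_span_sum[OF this[unfolded A_def]] obtain n :: nat and a b where
      ab: "\<forall>i<n. a i \<in> M \<and> b i \<in> ?Fr ` C" "x ^ p = (\<Sum>i<n. a i * b i)"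
      by (elim exE conjE)
    have "\<forall>i\<in>{..<n}. \<exists>e. e \<in> C \<and> b i = e ^ p" using ab(1) by blast
    from bchoice[OF this] obtain e where e: "\<And>i. i \<in> {..<n} \<Longrightarrow> e i \<in> C" "\<And>i. i \<in> {..<n} \<Longrightarrow> b i = e i ^ p"
      by blast
    have xs: "x ^ p = (\<Sum>i<n. a i * e i ^ p)" unfolding ab(2) by (intro sum.cong refl) (simp add: e(2))
    have "a i \<in> M" if "i \<in> {..<n}" for i using ab(1) that by blast
    then have "x \<in> C" by (rule separable_belowD[OF p M C finite_lessThan _ e(1) xs])
    then show False using x(1) by simp
  qed
  \<comment> \<open>Zorn's lemma is applied above \<open>A\<close>, so that the maximal member
    contains all p-th powers of \<open>C\<close>.\<close>
  define \<A> where "\<A> = {E. is_subfield E \<and> A \<subseteq> E \<and> E \<subseteq> C \<and> x ^ p \<notin> E}"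
  have "\<exists>E\<in>\<A>. \<forall>E'\<in>\<A>. E \<subseteq> E' \<longrightarrow> E' = E"
  proof (rule subset_Zorn_nonempty)
    show "\<A> \<noteq> {}" unfolding \<A>_def using A AC cA by blast
    fix \<C> assume ch: "\<C> \<noteq> {}" "subset.chain \<A> \<C>"
    have "is_subfield (\<Union>\<C>)" by (rule chain_Union_subfield[OF ch]) (simp add: \<A>_def)
    moreover have "\<C> \<subseteq> \<A>" using ch(2) unfolding subset.chain_def by blast
    ultimately show "\<Union>\<C> \<in> \<A>" using ch(1) unfolding \<A>_def by blast
  qed
  then obtain E where E: "E \<in> \<A>" and max: "\<And>E'. E' \<in> \<A> \<Longrightarrow> E \<subseteq> E' \<Longrightarrow> E' = E" by blast
  have E': "is_subfield E" "A \<subseteq> E" "E \<subseteq> C" "x ^ p \<notin> E" using E unfolding \<A>_def by blast+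
  have frob: "y ^ p \<in> E" if "y \<in> C" for y using frobA[OF that] E'(2) by blast
  have "E' = E" if "is_subfield E'" "E \<subseteq> E'" "E' \<subseteq> C" "x ^ p \<notin> E'" for E'
    using max[of E'] that E'(2) unfolding \<A>_def by blast
  then have "power_basis E C p (x ^ p)"
    by (intro simple_extension_power_basis[OF p C(1) E'(1,3) frob x(2) E'(4)])
  moreover have "M \<subseteq> E" using MA E'(2) by blast
  ultimately show ?thesis using E' frob[OF x(2)] by blast
qed

text \<open>The products of the two bases are the powers \<open>t ^ (j * L + b)\<close> with
  \<open>j < p\<close> and \<open>b < L\<close>; division with remainder by \<open>L\<close> lists
  each exponent below \<open>p * L\<close> exactly once.\<close>

lemma power_basis_tower:
  assumes EC: "power_basis E C p (t ^ L)" and CK: "power_basis C K L t"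
    and E: "is_subfield E" "E \<subseteq> C" and C: "is_subfield C" and t: "t ^ L \<in> C"
  shows "power_basis E K (p * L) t"
proof -
  have split: "(\<Sum>k<p * L. f k * t ^ k) = (\<Sum>b<L. (\<Sum>j<p. f (j * L + b) * (t ^ L) ^ j) * t ^ b)"
    for f :: "nat \<Rightarrow> 'a"
  proof -
    have "(\<Sum>k<p * L. f k * t ^ k) = (\<Sum>j<p. \<Sum>k=j * L..<j * L + L. f k * t ^ k)"
      by (rule sum.nat_group[symmetric])
    also have "\<dots> = (\<Sum>j<p. \<Sum>b<L. f (j * L + b) * t ^ (j * L + b))"
      by (rule sum.cong[OF refl], subst sum.atLeastLessThan_shift_0) (simp add: atLeast0LessThan)
    also have "\<dots> = (\<Sum>b<L. \<Sum>j<p. f (j * L + b) * t ^ (j * L + b))"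
      by (rule sum.swap)
    also have "\<dots> = (\<Sum>b<L. (\<Sum>j<p. f (j * L + b) * (t ^ L) ^ j) * t ^ b)"
      by (simp add: sum_distrib_left power_add mult_ac flip: power_mult)
    finally show ?thesis .
  qed
  show ?thesis
    unfolding power_basis_def
  proof (intro conjI ballI allI impI; (elim conjE)?)
    fix x assume "x \<in> K"
    then obtain g where g: "\<forall>b. g b \<in> C" "x = (\<Sum>b<L. g b * t ^ b)"
      using CK unfolding power_basis_def by blast
    have "\<forall>b. \<exists>f. (\<forall>j. f j \<in> E) \<and> g b = (\<Sum>j<p. f j * (t ^ L) ^ j)"
      using EC g(1) unfolding power_basis_def by blast
    from choice[OF this] obtain f where f: "\<And>b j. f b j \<in> E" "\<And>b. g b = (\<Sum>j<p. f b j * (t ^ L) ^ j)"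
      by blast
    define h where "h k = f (k mod L) (k div L)" for k
    have "x = (\<Sum>k<p * L. h k * t ^ k)"
      unfolding split g(2) f(2) by (intro sum.cong refl) (simp add: h_def)
    then show "\<exists>f. (\<forall>b. f b \<in> E) \<and> x = (\<Sum>b<p * L. f b * t ^ b)"
      using f(1) by (intro exI[of _ h]) (simp add: h_def)
  next
    fix f k assume f: "\<forall>b. f b \<in> E" "(\<Sum>b<p * L. f b * t ^ b) = 0" and k: "k < p * L"
    define g where "g b = (\<Sum>j<p. f (j * L + b) * (t ^ L) ^ j)" for b
    have "\<forall>b. g b \<in> C"
      unfolding g_def using f(1) E(2) t
      by (auto intro!: subfield_sum[OF C] subfield_mult[OF C] subfield_power[OF C])
    moreover have "(\<Sum>b<L. g b * t ^ b) = 0" using f(2) unfolding split g_def .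
    ultimately have g0: "\<forall>b<L. g b = 0" using CK unfolding power_basis_def by blast
    have L: "L > 0" using k by (cases L) auto
    have "g (k mod L) = 0" using g0 L by simp
    with f(1) have "(\<forall>j. f (j * L + k mod L) \<in> E) \<and> (\<Sum>j<p. f (j * L + k mod L) * (t ^ L) ^ j) = 0"
      unfolding g_def by blast
    then have "\<forall>j<p. f (j * L + k mod L) = 0"
      by (rule EC[unfolded power_basis_def, THEN conjunct2, THEN spec, THEN mp])
    moreover have "k div L < p" using k by (simp add: less_mult_imp_div_less)
    ultimately have "f (k div L * L + k mod L) = 0" by blast
    then show "f k = 0" by simp
  qed
qed

section \<open>Derivations and gradings\<close>

lemma coeff_one_plus_X_power: "coeff ([:1, 1:] ^ n :: 'a::comm_ring_1 poly) i = of_nat (n choose i)"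
  by (cases "i \<le> n") (simp_all add: coeff_linear_poly_power binomial_eq_0 coeff_eq_0 degree_linear_power)

text \<open>In characteristic \<open>p\<close>, \<open>(1 + X)^(p^m) = 1 + X^(p^m)\<close>, and
  multiplication by this leaves all coefficients below \<open>p^m\<close> unchanged. This is why
  degrees matter only modulo \<open>p^m\<close>.\<close>

lemma of_nat_choose_add_char_power:
  assumes p: "prime p" "CHAR('a::comm_ring_1) = p" and n: "n < p ^ m"
  shows "(of_nat ((a + p ^ m) choose n) :: 'a) = of_nat (a choose n)"
proof -
  let ?f = "[:1, 1:] :: 'a poly"
  have "?f ^ p ^ m = (1 + monom 1 1) ^ p ^ m"
    by (simp add: monom_altdef one_pCons)
  also have "\<dots> = 1 + monom 1 (p ^ m)"
    using p by (subst freshmans_dream'[where n = m]) (simp_all add: monom_power)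
  finally have "?f ^ (a + p ^ m) = ?f ^ a + monom 1 (p ^ m) * ?f ^ a"
    by (simp add: power_add algebra_simps)
  then have "coeff (?f ^ (a + p ^ m)) n = coeff (?f ^ a) n"
    using n by (simp add: coeff_monom_mult)
  then show ?thesis by (simp only: coeff_one_plus_X_power)
qed

lemma fps_one_plus_X_power_nth:
  "((1 + fps_X :: 'a::comm_ring_1 fps) ^ n) $ k = of_nat (n choose k)"
proof -
  have "(1 + fps_X :: 'a fps) ^ n = (\<Sum>j\<le>n. fps_const (of_nat (n choose j)) * fps_X ^ j)"
    by (subst add.commute) (simp add: binomial_ring fps_of_nat)
  then show ?thesis
    by (auto simp: fps_sum_nth fps_X_power_nth if_distrib binomial_eq_0 cong: if_cong)
qed

text \<open>Since \<open>G + 1 = (1 + X)(1 + Y)\<close>, the coefficient of \<open>X^i Y^j\<close>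
  in \<open>(G + 1)^a\<close> can be read off from the product or from the binomial expansion in
  \<open>G\<close>; there the terms with \<open>n > i + j\<close> do not contribute.\<close>

lemma fps2_group_law_binomial:
  fixes a i j :: nat
  defines "G \<equiv> fps2_X + fps2_Y + fps2_X * fps2_Y :: 'a::comm_ring_1 fps fps"
  shows "(\<Sum>n\<le>i + j. of_nat (a choose n) * (G ^ n) $ j $ i) = (of_nat (a choose i) * of_nat (a choose j) :: 'a)"
proof -
  have "(G + 1) ^ a = fps_const ((1 + fps_X) ^ a) * (1 + fps_X) ^ a"
  proof -
    have "G + 1 = fps_const (1 + fps_X) * (1 + fps_X)"
      by (simp add: G_def fps2_X_def fps2_Y_def algebra_simps flip: fps_const_add)
    then show ?thesis by (simp add: power_mult_distrib fps_const_power)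
  qed
  then have lhs: "((G + 1) ^ a) $ j $ i = of_nat (a choose i) * of_nat (a choose j)"
    by (simp add: fps_one_plus_X_power_nth fps_mult_of_nat_nth)
  have "((G + 1) ^ a) $ j $ i = (\<Sum>n\<le>a. of_nat (a choose n) * (G ^ n) $ j $ i)"
    by (simp add: binomial_ring fps_sum_nth mult.assoc fps_mult_of_nat_nth)
  also have "\<dots> = (\<Sum>n\<le>a + (i + j). of_nat (a choose n) * (G ^ n) $ j $ i)"
    by (intro sum.mono_neutral_left) (auto simp: binomial_eq_0)
  also have "\<dots> = (\<Sum>n\<le>i + j. of_nat (a choose n) * (G ^ n) $ j $ i)"
    unfolding G_def by (intro sum.mono_neutral_right) (auto simp: fps2_group_law_power_nth)
  finally show ?thesis using lhs by simp
qed

section \<open>From gradings to derivations\<close>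

lemma additive_sum:
  fixes f :: "'a::ab_group_add \<Rightarrow> 'b::ab_group_add"
  assumes "\<And>x y. f (x + y) = f x + f y"
  shows "f (sum g I) = (\<Sum>i\<in>I. f (g i))"
proof -
  have "f 0 = 0" using assms[of 0 0] by simp
  then show ?thesis by (induction I rule: infinite_finite_induct) (simp_all add: assms)
qed

lemma additive_of_nat_mult:
  fixes f :: "'a::ring_1 \<Rightarrow> 'b::ring_1"
  assumes add: "\<And>x y. f (x + y) = f x + f y"
  shows "f (of_nat c * x) = of_nat c * f x"
proof -
  have "f 0 + f 0 = f 0 + 0" using add[of 0 0] by simp
  then have "f 0 = 0" by (rule add_left_imp_eq)
  then show ?thesis by (induction c) (simp_all add: distrib_right add)
qed

text \<open>
  A \<open>\<bbbG>\<^sub>m\<close>-derivation is a grading in disguise: \<open>D\<^sub>n\<close> multiplies an element of degree \<open>a\<close> by the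
  binomial coefficient \<open>a\<close> over \<open>n\<close>. The gradings \<open>H N\<close> may vary with the bound \<open>N\<close> on \<open>n\<close>.
\<close>

lemma Gm_derivation_if_graded:
  fixes D :: "nat \<Rightarrow> 'a::field \<Rightarrow> 'a" and H :: "nat \<Rightarrow> nat \<Rightarrow> 'a set"
  assumes add: "\<And>n x y. D n (x + y) = D n x + D n y"
    and eigen: "\<And>N n a z. n \<le> N \<Longrightarrow> z \<in> H N a \<Longrightarrow> D n z = of_nat (a choose n) * z"
    and mult: "\<And>N a b x y. x \<in> H N a \<Longrightarrow> y \<in> H N b \<Longrightarrow> x * y \<in> H N (a + b)"
    and span: "\<And>N x. \<exists>(L::nat) z a. (\<forall>b<L. z b \<in> H N (a b)) \<and> x = (\<Sum>b<L. z b)"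
  shows "Gm_derivation D"
proof -
  have D_sum: "D n (sum g I) = (\<Sum>i\<in>I. D n (g i))" for n g and I :: "nat set"
    by (rule additive_sum[OF add])
  have D0: "D 0 = id"
  proof
    fix x obtain L :: nat and z a where z: "\<forall>b<L. z b \<in> H 0 (a b)" "x = (\<Sum>b<L. z b)"
      using span by blast
    have "D 0 x = (\<Sum>b<L. z b)"
      unfolding z(2) D_sum by (rule sum.cong[OF refl]) (use z(1) eigen[of 0 0] in auto)
    then show "D 0 x = id x" using z(2) by simp
  qed
  have D_mult: "D n (x * y) = (\<Sum>i\<le>n. D i x * D (n - i) y)" for n x y
  proof -
    obtain L :: nat and z a where z: "\<forall>b<L. z b \<in> H n (a b)" "x = (\<Sum>b<L. z b)"
      using span by blast
    obtain L' :: nat and z' a' where z': "\<forall>b<L'. z' b \<in> H n (a' b)" "y = (\<Sum>b<L'. z' b)"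
      using span by blast
    have hom: "D n (z b * z' c) = (\<Sum>i\<le>n. D i (z b) * D (n - i) (z' c))" if "b < L" "c < L'" for b c
    proof -
      have zb: "z b \<in> H n (a b)" "z' c \<in> H n (a' c)" using z(1) z'(1) that by auto
      have "D n (z b * z' c) = of_nat ((a b + a' c) choose n) * (z b * z' c)"
        using mult[OF zb] by (rule eigen[OF order_refl])
      also have "\<dots> = (\<Sum>i\<le>n. of_nat (a b choose i) * of_nat (a' c choose (n - i)) * (z b * z' c))"
        by (simp add: sum_distrib_right flip: vandermonde)
      also have "\<dots> = (\<Sum>i\<le>n. D i (z b) * D (n - i) (z' c))"
      proof (rule sum.cong[OF refl])
        fix i assume "i \<in> {..n}"
        then have "D i (z b) = of_nat (a b choose i) * z b" "D (n - i) (z' c) = of_nat (a' c choose (n - i)) * z' c"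
          using eigen[OF _ zb(1), of i] eigen[OF _ zb(2), of "n - i"] by simp_all
        then show "of_nat (a b choose i) * of_nat (a' c choose (n - i)) * (z b * z' c) = D i (z b) * D (n - i) (z' c)"
          by (simp add: mult_ac)
      qed
      finally show ?thesis .
    qed
    have "D n (x * y) = (\<Sum>b<L. \<Sum>c<L'. D n (z b * z' c))"
      by (simp add: z(2) z'(2) sum_product D_sum)
    also have "\<dots> = (\<Sum>b<L. \<Sum>c<L'. \<Sum>i\<le>n. D i (z b) * D (n - i) (z' c))"
      by (intro sum.cong[OF refl] hom) simp_all
    also have "\<dots> = (\<Sum>b<L. \<Sum>i\<le>n. \<Sum>c<L'. D i (z b) * D (n - i) (z' c))"
      by (rule sum.cong[OF refl sum.swap])
    also have "\<dots> = (\<Sum>i\<le>n. \<Sum>b<L. \<Sum>c<L'. D i (z b) * D (n - i) (z' c))"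
      by (rule sum.swap)
    also have "\<dots> = (\<Sum>i\<le>n. D i x * D (n - i) y)"
      by (simp add: z(2) z'(2) sum_product D_sum)
    finally show ?thesis .
  qed
  let ?G = "fps2_X + fps2_Y + fps2_X * fps2_Y :: 'a fps fps"
  have iter: "D i (D j r) = (\<Sum>n\<le>i + j. D n r * (?G ^ n) $ j $ i)" for i j r
  proof -
    \<comment> \<open>Only \<open>D n\<close> with \<open>n \<le> i + j\<close> occur in this
      coefficient, so the grading for the bound \<open>i + j\<close> suffices.\<close>
    obtain L :: nat and z a where z: "\<forall>b<L. z b \<in> H (i + j) (a b)" "r = (\<Sum>b<L. z b)"
      using span by blast
    have hom: "D i (D j (z b)) = (\<Sum>n\<le>i + j. D n (z b) * (?G ^ n) $ j $ i)" if "b < L" for b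
    proof -
      have zb: "z b \<in> H (i + j) (a b)" using z(1) that by simp
      have scale: "D i (of_nat c * w) = of_nat c * D i w" for c w
        by (rule additive_of_nat_mult[OF add])
      have "D i (D j (z b)) = of_nat (a b choose i) * of_nat (a b choose j) * z b"
        using eigen[OF _ zb, of i] eigen[OF _ zb, of j] by (simp add: scale)
      also have "\<dots> = (\<Sum>n\<le>i + j. of_nat (a b choose n) * z b * (?G ^ n) $ j $ i)"
        unfolding fps2_group_law_binomial[symmetric] by (simp only: sum_distrib_left mult_ac)
      also have "\<dots> = (\<Sum>n\<le>i + j. D n (z b) * (?G ^ n) $ j $ i)"
        by (rule sum.cong[OF refl]) (simp add: eigen[OF _ zb])
      finally show ?thesis .
    qed
    have "D i (D j r) = (\<Sum>b<L. D i (D j (z b)))"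
      by (simp only: z(2) D_sum)
    also have "\<dots> = (\<Sum>b<L. \<Sum>n\<le>i + j. D n (z b) * (?G ^ n) $ j $ i)"
      by (rule sum.cong[OF refl]) (simp only: hom lessThan_iff)
    also have "\<dots> = (\<Sum>n\<le>i + j. \<Sum>b<L. D n (z b) * (?G ^ n) $ j $ i)"
      by (rule sum.swap)
    finally show ?thesis by (simp only: z(2) D_sum sum_distrib_right)
  qed
  have series: "fps2_sum (\<lambda>n. fps2_const (D n r) * ?G ^ n) $ j $ i = (\<Sum>n\<le>i + j. D n r * (?G ^ n) $ j $ i)"
    for i j r
  proof -
    have "Sum_any (\<lambda>n. (fps2_const (D n r) * ?G ^ n) $ j $ i) = (\<Sum>n\<le>i + j. (fps2_const (D n r) * ?G ^ n) $ j $ i)"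
    proof (rule Sum_any.expand_superset)
      show "{n. (fps2_const (D n r) * ?G ^ n) $ j $ i \<noteq> 0} \<subseteq> {..i + j}"
      proof
        fix n assume "n \<in> {n. (fps2_const (D n r) * ?G ^ n) $ j $ i \<noteq> 0}"
        then have "(?G ^ n) $ j $ i \<noteq> 0" by (simp only: mem_Collect_eq fps2_const_mult_nth) simp
        then show "n \<in> {..i + j}" using fps2_group_law_power_nth[of i j n] by (meson atMost_iff not_le)
      qed
    qed simp
    then show ?thesis by (simp only: fps2_sum_def fps_nth_Abs_fps fps2_const_mult_nth)
  qed
  have "fps2_sum (\<lambda>(i, j). fps2_const (D i (D j r)) * fps2_X ^ i * fps2_Y ^ j)
      = fps2_sum (\<lambda>n. fps2_const (D n r) * ?G ^ n)" for r
    by (intro fps_ext) (simp only: fps2_sum_monomials_nth series iter)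
  then show ?thesis
    unfolding Gm_derivation_def using add D0 D_mult by blast
qed

section \<open>Binomial inversion and the coefficients of the truncated group law\<close>

definition signed_choose :: "nat \<Rightarrow> nat \<Rightarrow> 'a::comm_ring_1" where
  "signed_choose a n = (-1) ^ (n - a) * of_nat (n choose a)"

text \<open>\<open>signed_choose a j\<close> is the coefficient of \<open>X^a\<close> in
  \<open>(X - 1)^j\<close>, so expanding \<open>X^e = ((X - 1) + 1)^e\<close> shows that it inverts
  the Pascal matrix. For \<open>a > j\<close> the truncated exponent is harmless, as the binomial
  coefficient is 0.\<close>

lemma sum_signed_choose_choose:
  assumes "e < q"
  shows "(\<Sum>j<q. signed_choose a j * of_nat (e choose j)) = (if a = e then 1 else 0 :: 'a::comm_ring_1)"
proof -
  have X: "[:-1, 1:] + 1 = (monom 1 1 :: 'a poly)"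
    by (simp add: monom_altdef one_pCons)
  have "monom 1 e = ([:-1, 1:] + 1 :: 'a poly) ^ e"
    unfolding X by (simp add: monom_power)
  also have "\<dots> = (\<Sum>j\<le>e. of_nat (e choose j) * [:-1, 1:] ^ j)"
    by (simp add: binomial_ring)
  finally have "coeff (monom 1 e) a = (\<Sum>j\<le>e. of_nat (e choose j) * coeff ([:-1, 1:] ^ j :: 'a poly) a)"
    by (simp add: coeff_sum of_nat_poly)
  also have "\<dots> = (\<Sum>j\<le>e. signed_choose a j * of_nat (e choose j))"
  proof (rule sum.cong[OF refl])
    fix j
    show "of_nat (e choose j) * coeff ([:-1, 1:] ^ j :: 'a poly) a = signed_choose a j * of_nat (e choose j)"
      by (cases "a \<le> j")
        (simp_all add: coeff_linear_poly_power signed_choose_def mult_ac binomial_eq_0 coeff_eq_0 degree_linear_power)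
  qed
  also have "\<dots> = (\<Sum>j<q. signed_choose a j * of_nat (e choose j))"
    using assms by (intro sum.mono_neutral_left) (auto simp: binomial_eq_0)
  finally show ?thesis by (auto simp: coeff_monom)
qed

lemma sum_signed_choose:
  assumes "n < q"
  shows "(\<Sum>a<q. signed_choose a n) = (if n = 0 then 1 else 0 :: 'a::comm_ring_1)"
proof -
  have "(\<Sum>a<q. signed_choose a n) = (\<Sum>a\<le>n. signed_choose a n :: 'a)"
    using assms by (intro sum.mono_neutral_right) (auto simp: signed_choose_def binomial_eq_0)
  also have "\<dots> = (1 + (-1)) ^ n"
    unfolding binomial_ring by (intro sum.cong) (auto simp: signed_choose_def)
  finally show ?thesis by (simp add: power_0_left)
qed

text \<open>The group law polynomial is \<open>P - 1\<close> with \<open>P = (1 + X)(1 + Y)\<close>,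
  and \<open>(P - 1)^n\<close> is expanded in powers of \<open>P\<close>. In this form the inversion
  formula applies to the sum over \<open>j\<close> in \<open>proj_homogeneous\<close>.\<close>

lemma poly2_group_law_power_coeff:
  assumes "n < q"
  shows "coeff (coeff ((poly2_X + poly2_Y + poly2_X * poly2_Y) ^ n) j) i
    = (\<Sum>e<q. signed_choose e n * of_nat (e choose i) * of_nat (e choose j) :: 'a::comm_ring_1)"
proof -
  let ?P = "[:[:1, 1:]:] * [:1, 1:] :: 'a poly poly"
  have P: "coeff (coeff (?P ^ e) j) i = of_nat (e choose i) * of_nat (e choose j)" for e
  proof -
    have "?P ^ e = [:[:1, 1:] ^ e:] * [:1, 1:] ^ e"
      by (simp only: power_mult_distrib poly_const_pow)
    then have "?P ^ e = smult ([:1, 1:] ^ e) ([:1, 1:] ^ e)"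
      by simp
    then have "coeff (coeff (?P ^ e) j) i = coeff ([:1, 1:] ^ e * of_nat (e choose j)) i"
      by (simp only: coeff_smult coeff_one_plus_X_power)
    also have "\<dots> = coeff ([:1, 1:] ^ e) i * of_nat (e choose j)"
      by (simp only: of_nat_poly mult.commute[of _ "[:_:]"] mult_pCons_left) (simp add: mult.commute)
    finally show ?thesis by (simp only: coeff_one_plus_X_power)
  qed
  have sc: "signed_choose e n = ([:[:signed_choose e n:]:] :: 'a poly poly)" for e
    by (cases "even (n - e)") (simp_all add: signed_choose_def of_nat_poly)
  have "(poly2_X + poly2_Y + poly2_X * poly2_Y :: 'a poly poly) = ?P + - 1"
    by (simp add: poly2_X_def poly2_Y_def one_pCons)
  then have "(poly2_X + poly2_Y + poly2_X * poly2_Y :: 'a poly poly) ^ n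
      = (\<Sum>e\<le>n. [:[:signed_choose e n:]:] * ?P ^ e)"
    unfolding sc[symmetric] by (simp only: binomial_ring signed_choose_def mult_ac)
  then have "coeff (coeff ((poly2_X + poly2_Y + poly2_X * poly2_Y) ^ n) j) i
      = (\<Sum>e\<le>n. signed_choose e n * coeff (coeff (?P ^ e) j) i)"
    by (simp only: coeff_sum mult_pCons_left) simp
  also have "\<dots> = (\<Sum>e\<le>n. signed_choose e n * of_nat (e choose i) * of_nat (e choose j))"
    by (simp only: P mult.assoc)
  also have "\<dots> = (\<Sum>e<q. signed_choose e n * of_nat (e choose i) * of_nat (e choose j))"
    using assms by (intro sum.mono_neutral_left) (auto simp: signed_choose_def binomial_eq_0)
  finally show ?thesis .
qed

lemma poly2_cong_coeff:
  fixes f g :: "'a::comm_ring_1 poly poly"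
  assumes "poly2_cong q f g" and "i < q" "j < q"
  shows "coeff (coeff f j) i = coeff (coeff g j) i"
proof -
  obtain a b where ab: "f - g = a * poly2_X ^ q + b * poly2_Y ^ q"
    using assms(1) unfolding poly2_cong_def by blast
  have "a * poly2_X ^ q = smult (monom 1 q) a"
    by (simp add: poly2_X_def poly_const_pow monom_altdef)
  moreover have "b * poly2_Y ^ q = monom 1 q * b"
    by (simp add: poly2_Y_def monom_altdef)
  ultimately have "coeff (coeff (f - g) j) i = 0"
    using assms(2,3) by (simp add: ab coeff_monom_mult)
  then show ?thesis by simp
qed

lemma poly2_monomial_coeff:
  "coeff (coeff (poly2_const c * poly2_X ^ a * poly2_Y ^ b) j) i = (if i = a \<and> j = b then c else 0)"
proof -
  have "poly2_const c * poly2_X ^ a * poly2_Y ^ b = smult (smult c (monom 1 a)) (monom 1 b)"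
    by (simp add: poly2_const_def poly2_X_def poly2_Y_def poly_const_pow monom_altdef)
  then show ?thesis by auto
qed

lemma Gm_trunc_derivation_comp:
  fixes d :: "nat \<Rightarrow> 'a::field \<Rightarrow> 'a"
  assumes d: "Gm_trunc_derivation m d" and q: "q = CHAR('a) ^ m" and ij: "i < q" "j < q"
  shows "d i (d j r) = (\<Sum>n<q. d n r * (\<Sum>e<q. signed_choose e n * of_nat (e choose i) * of_nat (e choose j)))"
proof -
  have "poly2_cong q
      (\<Sum>i<q. \<Sum>j<q. poly2_const (d i (d j r)) * poly2_X ^ i * poly2_Y ^ j)
      (\<Sum>n<q. poly2_const (d n r) * (poly2_X + poly2_Y + poly2_X * poly2_Y) ^ n)"
    using d unfolding Gm_trunc_derivation_def q Let_def by blast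
  from poly2_cong_coeff[OF this ij]
  have "(\<Sum>i'<q. \<Sum>j'<q. if i = i' \<and> j = j' then d i' (d j' r) else 0)
      = (\<Sum>n<q. coeff (coeff (poly2_const (d n r) * (poly2_X + poly2_Y + poly2_X * poly2_Y) ^ n) j) i)"
    by (simp only: coeff_sum poly2_monomial_coeff)
  moreover have "(\<Sum>i'<q. \<Sum>j'<q. if i = i' \<and> j = j' then d i' (d j' r) else 0) = d i (d j r)"
  proof -
    have "(\<Sum>j'<q. if i = i' \<and> j = j' then d i' (d j' r) else 0) = (if i = i' then d i' (d j r) else 0)" for i'
      using ij by simp
    then show ?thesis using ij by simp
  qed
  moreover have "coeff (coeff (poly2_const (d n r) * f) j) i = d n r * coeff (coeff f j) i" for n f
    by (simp add: poly2_const_def)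
  ultimately show ?thesis
    by (simp add: poly2_group_law_power_coeff[where q = q])
qed

text \<open>The inversion coefficients are integers up to the canonical map, so additive maps
  commute with them.\<close>

lemma signed_choose_of_nat:
  "signed_choose a n = (of_nat (n choose a) :: 'a::comm_ring_1) \<or> (signed_choose a n :: 'a) = - of_nat (n choose a)"
  by (cases "even (n - a)") (simp_all add: signed_choose_def)

section \<open>The grading given by a truncated derivation\<close>

locale Gm_trunc =
  fixes d :: "nat \<Rightarrow> 'a::field \<Rightarrow> 'a" and p m q :: nat
  assumes prime_p: "prime p" and char_p: "CHAR('a) = p" and q: "q = p ^ m"
    and trunc: "Gm_trunc_derivation m d" and one: "n > 0 \<Longrightarrow> n < q \<Longrightarrow> d n 1 = 0"
begin

lemma q_pos: "q > 0"
  using prime_p by (simp add: q prime_gt_0_nat)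

lemma d_0: "d 0 = id"
  using trunc by (simp add: Gm_trunc_derivation_def Let_def)

lemma d_add: "n < q \<Longrightarrow> d n (x + y) = d n x + d n y"
  using trunc by (simp add: Gm_trunc_derivation_def Let_def char_p q)

lemma d_mult: "n < q \<Longrightarrow> d n (x * y) = (\<Sum>i\<le>n. d i x * d (n - i) y)"
  using trunc by (simp add: Gm_trunc_derivation_def Let_def char_p q)

lemma d_comp:
  "i < q \<Longrightarrow> j < q \<Longrightarrow>
    d i (d j r) = (\<Sum>n<q. d n r * (\<Sum>e<q. signed_choose e n * of_nat (e choose i) * of_nat (e choose j)))"
  by (rule Gm_trunc_derivation_comp[OF trunc]) (simp_all add: char_p q)

lemma d_sum: "n < q \<Longrightarrow> d n (sum g I) = (\<Sum>i\<in>I. d n (g i))"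
  by (rule additive_sum) (rule d_add)

lemma d_uminus: assumes n: "n < q" shows "d n (- x) = - d n x"
proof -
  have "d n 0 = 0" using additive_of_nat_mult[of "d n" 0 0, OF d_add[OF n]] by simp
  then show ?thesis using d_add[OF n, of x "- x"] by (simp add: minus_unique)
qed

lemma d_signed_choose: assumes n: "n < q" shows "d n (signed_choose a k * x) = signed_choose a k * d n x"
proof -
  have "d n (of_nat c * x) = of_nat c * d n x" for c
    by (rule additive_of_nat_mult) (rule d_add[OF n])
  then show ?thesis
    using signed_choose_of_nat[of a k, where 'a = 'a] by (auto simp: d_uminus[OF n])
qed

text \<open>The natural number \<open>a\<close> stands for its class modulo \<open>q\<close>, by
  \<open>homogeneous_period\<close>.\<close>

definition homogeneous :: "nat \<Rightarrow> 'a set" where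
  "homogeneous a = {x. \<forall>n<q. d n x = of_nat (a choose n) * x}"

text \<open>If \<open>x\<close> is a sum of components \<open>x_e\<close> of degree
  \<open>e < q\<close>, then \<open>d n x\<close> is the sum of the \<open>(e choose n) x_e\<close>.
  Inverting the Pascal matrix recovers \<open>x_a\<close>.\<close>

definition proj :: "nat \<Rightarrow> 'a \<Rightarrow> 'a" where
  "proj a x = (\<Sum>n<q. signed_choose a n * d n x)"

lemma homogeneousD: "x \<in> homogeneous a \<Longrightarrow> n < q \<Longrightarrow> d n x = of_nat (a choose n) * x"
  by (simp add: homogeneous_def)

lemma homogeneous_period: "homogeneous (a + q * k) = homogeneous a"
proof (induction k)
  case (Suc k)
  have "of_nat ((b + q) choose n) = (of_nat (b choose n) :: 'a)" if "n < q" for b n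
    using of_nat_choose_add_char_power[OF prime_p char_p] that unfolding q .
  then have "homogeneous (a + q * k + q) = homogeneous (a + q * k)"
    by (simp add: homogeneous_def)
  then show ?case using Suc by (simp add: ac_simps)
qed simp

lemma homogeneous_mult:
  assumes x: "x \<in> homogeneous a" and y: "y \<in> homogeneous b"
  shows "x * y \<in> homogeneous (a + b)"
proof -
  have "d n (x * y) = of_nat ((a + b) choose n) * (x * y)" if n: "n < q" for n
  proof -
    have "d n (x * y) = (\<Sum>i\<le>n. of_nat (a choose i) * of_nat (b choose (n - i)) * (x * y))"
      unfolding d_mult[OF n]
    proof (rule sum.cong[OF refl])
      fix i assume "i \<in> {..n}"
      then have "i < q" "n - i < q" using n by auto
      then show "d i x * d (n - i) y = of_nat (a choose i) * of_nat (b choose (n - i)) * (x * y)"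
        by (simp add: homogeneousD[OF x] homogeneousD[OF y] mult_ac)
    qed
    then show ?thesis by (simp add: sum_distrib_right flip: vandermonde)
  qed
  then show ?thesis by (simp add: homogeneous_def)
qed

lemma one_homogeneous: "1 \<in> homogeneous 0"
  unfolding homogeneous_def mem_Collect_eq
proof (intro allI impI)
  fix n assume "n < q"
  then show "d n 1 = of_nat (0 choose n) * 1"
    by (cases "n = 0") (simp_all add: d_0 one binomial_eq_0)
qed

lemma homogeneous_power: "x \<in> homogeneous a \<Longrightarrow> x ^ n \<in> homogeneous (a * n)"
  by (induction n) (auto simp: one_homogeneous dest: homogeneous_mult)

text \<open>After expanding \<open>d i (d j x)\<close> by \<open>d_comp\<close>, the sum over
  \<open>j\<close> against \<open>signed_choose a j\<close> leaves only \<open>e = a\<close>, and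
  the eigenvalue \<open>a choose i\<close> factors out.\<close>

lemma proj_homogeneous:
  assumes a: "a < q"
  shows "proj a x \<in> homogeneous a"
proof -
  have "d i (proj a x) = of_nat (a choose i) * proj a x" if i: "i < q" for i
  proof -
    have "d i (proj a x) = (\<Sum>j<q. signed_choose a j * d i (d j x))"
      unfolding proj_def d_sum[OF i] by (simp only: d_signed_choose[OF i])
    also have "\<dots> = (\<Sum>j<q. \<Sum>n<q. \<Sum>e<q. signed_choose a j *
        (d n x * (signed_choose e n * of_nat (e choose i) * of_nat (e choose j))))"
      by (rule sum.cong[OF refl]) (simp only: d_comp[OF i] lessThan_iff sum_distrib_left)
    also have "\<dots> = (\<Sum>n<q. \<Sum>e<q. \<Sum>j<q. signed_choose a j *
        (d n x * (signed_choose e n * of_nat (e choose i) * of_nat (e choose j))))"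
      by (subst sum.swap, rule sum.cong[OF refl], rule sum.swap)
    also have "\<dots> = (\<Sum>n<q. \<Sum>e<q. d n x * signed_choose e n * of_nat (e choose i) *
        (\<Sum>j<q. signed_choose a j * of_nat (e choose j)))"
      by (simp only: sum_distrib_left mult_ac)
    also have "\<dots> = (\<Sum>n<q. \<Sum>e<q. if a = e then d n x * signed_choose a n * of_nat (a choose i) else 0)"
      by (intro sum.cong[OF refl]) (simp add: sum_signed_choose_choose[where q = q])
    also have "\<dots> = (\<Sum>n<q. d n x * signed_choose a n * of_nat (a choose i))"
      using a by simp
    finally show ?thesis by (simp add: proj_def sum_distrib_left mult_ac)
  qed
  then show ?thesis by (simp add: homogeneous_def)
qed

lemma sum_proj: "(\<Sum>a<q. proj a x) = x"
proof -
  have "(\<Sum>a<q. proj a x) = (\<Sum>n<q. \<Sum>a<q. signed_choose a n * d n x)"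
    unfolding proj_def by (rule sum.swap)
  also have "\<dots> = (\<Sum>n<q. if n = 0 then d n x else 0)"
    by (rule sum.cong[OF refl]) (simp add: sum_signed_choose[where q = q] flip: sum_distrib_right)
  also have "\<dots> = x" using q_pos by (simp add: d_0)
  finally show ?thesis .
qed

lemma proj_add: "proj a (x + y) = proj a x + proj a y"
  by (simp add: proj_def d_add distrib_left sum.distrib)

lemma proj_of_homogeneous:
  assumes "x \<in> homogeneous b" "b < q"
  shows "proj a x = (if a = b then x else 0)"
proof -
  have "proj a x = (\<Sum>n<q. signed_choose a n * of_nat (b choose n)) * x"
    unfolding proj_def sum_distrib_right
    by (rule sum.cong[OF refl]) (simp add: homogeneousD[OF assms(1)])
  then show ?thesis using assms(2) by (simp add: sum_signed_choose_choose)
qed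

lemma homogeneous_diff:
  assumes "x \<in> homogeneous a" "y \<in> homogeneous a"
  shows "x - y \<in> homogeneous a"
proof -
  have "d n (x - y) = d n x - d n y" if "n < q" for n
    using d_add[OF that, of x "- y"] by (simp add: d_uminus[OF that])
  then show ?thesis using assms by (simp add: homogeneous_def right_diff_distrib)
qed

text \<open>For inverses, the product rule is applied to \<open>x * inverse x = 1\<close>: for
  \<open>n > 0\<close> the left side is 0 and only the term \<open>x * d n (inverse x)\<close>
  survives.\<close>

lemma subfield_homogeneous_0: "is_subfield (homogeneous 0)"
proof -
  have "inverse x \<in> homogeneous 0" if x: "x \<in> homogeneous 0" for x
  proof (cases "x = 0")
    case False
    have "d n (inverse x) = of_nat (0 choose n) * inverse x" if n: "n < q" for n
    proof (cases "n = 0")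
      case n0: False
      have "0 = d n (x * inverse x)" using n n0 one False by simp
      also have "\<dots> = (\<Sum>i\<le>n. if i = 0 then x * d n (inverse x) else 0)"
        unfolding d_mult[OF n]
      proof (rule sum.cong[OF refl])
        fix i assume "i \<in> {..n}"
        then show "d i x * d (n - i) (inverse x) = (if i = 0 then x * d n (inverse x) else 0)"
          using n homogeneousD[OF x, of i] by (simp add: binomial_eq_0)
      qed
      also have "\<dots> = x * d n (inverse x)" by simp
      finally show ?thesis using False n0 by (simp add: binomial_eq_0)
    qed (simp add: d_0)
    then show ?thesis by (simp add: homogeneous_def)
  qed (use x in simp)
  moreover have "x * y \<in> homogeneous 0" if "x \<in> homogeneous 0" "y \<in> homogeneous 0" for x y
    using homogeneous_mult[OF that] by simp
  moreover have "0 \<in> homogeneous 0"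
    using homogeneous_diff[OF one_homogeneous one_homogeneous] by simp
  ultimately show ?thesis
    unfolding is_subfield_def using homogeneous_diff one_homogeneous by blast
qed

text \<open>Degrees count modulo \<open>q\<close>, so multiplying by \<open>t ^ (q - 1)\<close>
  lowers the degree by \<open>g\<close> without using inverses. Doing this \<open>a div g\<close>
  times leaves a nonzero element of degree \<open>a mod g\<close>, against the minimality of
  \<open>g\<close>.\<close>

lemma homogeneous_dvd:
  assumes t: "t \<in> homogeneous g" "t \<noteq> 0" "g > 0"
    and least: "\<And>a y. a > 0 \<Longrightarrow> y \<in> homogeneous a \<Longrightarrow> y \<noteq> 0 \<Longrightarrow> g \<le> a"
    and x: "x \<in> homogeneous a" "x \<noteq> 0"
  shows "g dvd a"
proof (rule ccontr)
  assume "\<not> g dvd a"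
  then have pos: "a mod g > 0" by (simp add: mod_greater_zero_iff_not_dvd)
  obtain q' where q': "q = Suc q'" using q_pos gr0_implies_Suc by blast
  have a: "a mod g + g * (a div g) = a" by simp
  have "x * t ^ ((q - 1) * (a div g)) \<in> homogeneous (a + g * ((q - 1) * (a div g)))"
    by (intro homogeneous_mult x homogeneous_power t)
  also have "a + g * ((q - 1) * (a div g)) = a mod g + q * (g * (a div g))"
    by (subst (1) a[symmetric]) (simp add: q' algebra_simps del: mod_mult_div_eq mult_div_mod_eq)
  finally have "x * t ^ ((q - 1) * (a div g)) \<in> homogeneous (a mod g)"
    unfolding homogeneous_period .
  then have "g \<le> a mod g" using least[OF pos] x(2) t(2) by simp
  then show False using t(3) by (meson mod_less_divisor not_le)
qed

lemma power_basis_homogeneous: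
  assumes t: "t \<in> homogeneous g" "t \<noteq> 0" "g > 0" and L: "g * L = q"
    and dvd: "\<And>x a. x \<in> homogeneous a \<Longrightarrow> x \<noteq> 0 \<Longrightarrow> g dvd a"
  shows "power_basis (homogeneous 0) UNIV L t"
  unfolding power_basis_def
proof (intro conjI ballI allI impI; (elim conjE)?)
  fix x
  \<comment> \<open>The component of degree \<open>g * b\<close> divided by \<open>t ^ b\<close> has
    degree 0; the value 0 from \<open>L\<close> on keeps the whole family among the
    constants.\<close>
  define f where "f b = (if b < L then proj (g * b) x / t ^ b else 0)" for b
  have f: "f b \<in> homogeneous 0" for b
  proof (cases "b < L")
    case True
    then have b: "g * b < q" using t(3) L by (metis nat_mult_less_cancel_disj)
    \<comment> \<open>The quotient is rewritten with \<open>(t ^ b) ^ q\<close> as denominator, so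
      that numerator and denominator both have degree 0 and lie in the field of constants.\<close>
    have "(t ^ b) ^ q \<in> homogeneous (g * b * q)"
      using t(1) by (intro homogeneous_power)
    then have tq: "(t ^ b) ^ q \<in> homogeneous 0"
      using homogeneous_period[of 0 "g * b"] by (simp add: mult.commute)
    have q1: "q = Suc (q - 1)" using q_pos by simp
    have "proj (g * b) x * (t ^ b) ^ (q - 1) \<in> homogeneous (g * b + g * b * (q - 1))"
      using t(1) b by (intro homogeneous_mult homogeneous_power proj_homogeneous)
    also have "g * b + g * b * (q - 1) = 0 + q * (g * b)"
      by (subst (2) q1) simp
    finally have "proj (g * b) x * (t ^ b) ^ (q - 1) \<in> homogeneous 0"
      unfolding homogeneous_period .
    then have "proj (g * b) x * (t ^ b) ^ (q - 1) / (t ^ b) ^ q \<in> homogeneous 0"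
      using tq by (rule subfield_divide[OF subfield_homogeneous_0])
    moreover have "proj (g * b) x * (t ^ b) ^ (q - 1) / (t ^ b) ^ q = f b"
      by (subst (2) q1) (simp add: f_def True t(2))
    ultimately show ?thesis by simp
  qed (simp add: f_def subfield_zero[OF subfield_homogeneous_0])
  have inj: "inj_on ((*) g) {..<L}" using t(3) by (auto simp: inj_on_def)
  have "x = (\<Sum>a<q. proj a x)" by (simp add: sum_proj)
  also have "\<dots> = (\<Sum>a\<in>(*) g ` {..<L}. proj a x)"
  proof (rule sum.mono_neutral_right)
    show "(*) g ` {..<L} \<subseteq> {..<q}" using t(3) unfolding L[symmetric] by auto
    show "\<forall>a\<in>{..<q} - (*) g ` {..<L}. proj a x = 0"
    proof (intro ballI, rule ccontr)
      fix a assume a: "a \<in> {..<q} - (*) g ` {..<L}" "proj a x \<noteq> 0"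
      then have "g dvd a" using dvd[OF proj_homogeneous] by blast
      then obtain b where b: "a = g * b" by (rule dvdE)
      then have "g * b < g * L" using a(1) L by simp
      then show False using a(1) b by simp
    qed
  qed simp
  also have "\<dots> = (\<Sum>b<L. f b * t ^ b)"
    unfolding sum.reindex[OF inj] using t(2) by (simp add: f_def)
  finally show "\<exists>f. (\<forall>b. f b \<in> homogeneous 0) \<and> x = (\<Sum>b<L. f b * t ^ b)"
    using f by blast
next
  fix f b assume f: "\<forall>b. f b \<in> homogeneous 0" "(\<Sum>b<L. f b * t ^ b) = 0" and b: "b < L"
  have hom: "f c * t ^ c \<in> homogeneous (g * c)" for c
    using homogeneous_mult[OF f(1)[rule_format] homogeneous_power[OF t(1)], of c c] by simp
  \<comment> \<open>The terms of the relation have distinct degrees below \<open>q\<close>, so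
    projecting to degree \<open>g * b\<close> isolates one of them.\<close>
  have "0 = proj (g * b) (\<Sum>c<L. f c * t ^ c)"
    unfolding f(2) using additive_of_nat_mult[of "proj (g * b)" 0 0, OF proj_add] by simp
  also have "\<dots> = (\<Sum>c<L. proj (g * b) (f c * t ^ c))"
    by (rule additive_sum) (rule proj_add)
  also have "\<dots> = (\<Sum>c<L. if b = c then f c * t ^ c else 0)"
  proof (rule sum.cong[OF refl])
    fix c assume "c \<in> {..<L}"
    then have "g * c < q" using t(3) unfolding L[symmetric] by simp
    then show "proj (g * b) (f c * t ^ c) = (if b = c then f c * t ^ c else 0)"
      using proj_of_homogeneous[OF hom] t(3) by simp
  qed
  finally show "f b = 0" using b t(2) by simp
qed

text \<open>The least positive degree \<open>g\<close> of a nonzero element divides all degrees, in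
  particular the degree \<open>q\<close> of 1, so it is some \<open>p ^ k\<close>. For
  \<open>k = m\<close> everything has degree 0; otherwise an element of degree \<open>g\<close>
  generates. The power outside the constants is where the later chain of subfields starts.\<close>

lemma trivial_or_power_basis:
  "(\<forall>n x. 0 < n \<longrightarrow> n < q \<longrightarrow> d n x = 0) \<or>
   (\<exists>k t. k < m \<and> t \<in> homogeneous (p ^ k) \<and> t ^ p ^ (m - k) \<in> homogeneous 0 \<and>
     t ^ p ^ (m - k - 1) \<notin> homogeneous 0 \<and> power_basis (homogeneous 0) UNIV (p ^ (m - k)) t)"
proof -
  define P where "P a \<longleftrightarrow> a > 0 \<and> (\<exists>t\<in>homogeneous a. t \<noteq> 0)" for a
  define g where "g = (LEAST a. P a)"
  have "P q"
    unfolding P_def using q_pos one_homogeneous homogeneous_period[of 0 1] by (auto intro!: bexI[of _ 1])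
  then have "P g" unfolding g_def by (rule LeastI)
  then obtain t where t: "t \<in> homogeneous g" "t \<noteq> 0" "g > 0" unfolding P_def by blast
  have least: "g \<le> a" if "a > 0" "y \<in> homogeneous a" "y \<noteq> 0" for a y
    unfolding g_def by (rule Least_le) (use that in \<open>auto simp: P_def\<close>)
  have dvd: "g dvd a" if "x \<in> homogeneous a" "x \<noteq> 0" for x a
    by (rule homogeneous_dvd[OF t _ that]) (rule least)
  have "g dvd p ^ m"
    using dvd[of 1 q] one_homogeneous homogeneous_period[of 0 1] by (simp add: q)
  then obtain k where k: "k \<le> m" "g = p ^ k"
    using divides_primepow_nat[OF prime_p] by blast
  show ?thesis
  proof (cases "k = m")
    case True
    then have gq: "g = q" using k q by simp
    have "d n x = 0" if n: "0 < n" "n < q" for n x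
    proof -
      have "proj a x = 0" if "0 < a" "a < q" for a
      proof -
        have "\<not> g dvd a" using that unfolding gq by (auto dest: dvd_imp_le)
        then show ?thesis using dvd[OF proj_homogeneous[OF that(2)]] by blast
      qed
      then have "(\<Sum>a<q. proj a x) = (\<Sum>a\<in>{0}. proj a x)"
        using q_pos by (intro sum.mono_neutral_right) auto
      then have "x \<in> homogeneous 0" using proj_homogeneous[OF q_pos, of x] sum_proj by simp
      then show ?thesis using homogeneousD[OF _ n(2)] n(1) by (simp add: binomial_eq_0)
    qed
    then show ?thesis by blast
  next
    case False
    then have km: "k < m" using k(1) by simp
    have gL: "g * p ^ (m - k) = q" using km by (simp add: k(2) q flip: power_add)
    have "t ^ p ^ (m - k) \<in> homogeneous (g * p ^ (m - k))" by (rule homogeneous_power[OF t(1)])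
    then have "t ^ p ^ (m - k) \<in> homogeneous 0"
      unfolding gL using homogeneous_period[of 0 1] by simp
    moreover have "t ^ p ^ (m - k - 1) \<notin> homogeneous 0"
    proof
      let ?x = "t ^ p ^ (m - k - 1)"
      assume 0: "?x \<in> homogeneous 0"
      \<comment> \<open>This power of \<open>t\<close> has degree \<open>p ^ (m - 1)\<close>,
        strictly between 0 and \<open>q\<close>; a nonzero element cannot have degree 0 as
        well.\<close>
      have a: "g * p ^ (m - k - 1) = p ^ (m - 1)" using km by (simp add: k(2) flip: power_add)
      have x: "?x \<in> homogeneous (p ^ (m - 1))"
        using homogeneous_power[OF t(1), of "p ^ (m - k - 1)"] unfolding a .
      have p1: "p > 1" using prime_p prime_gt_1_nat by blast
      then have lt: "p ^ (m - 1) < q" unfolding q using km by (intro power_strict_increasing) auto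
      have nz: "p ^ (m - 1) \<noteq> 0" using p1 by simp
      have "proj (p ^ (m - 1)) ?x = 0"
        using proj_of_homogeneous[OF 0 q_pos, of "p ^ (m - 1)"] unfolding if_not_P[OF nz] .
      moreover have "proj (p ^ (m - 1)) ?x = ?x"
        using proj_of_homogeneous[OF x lt, of "p ^ (m - 1)"] unfolding if_P[OF refl] .
      ultimately have "?x = 0" by simp
      then show False using t(2) by simp
    qed
    moreover have "power_basis (homogeneous 0) UNIV (p ^ (m - k)) t"
      by (rule power_basis_homogeneous[OF t gL dvd])
    ultimately show ?thesis using km t(1) k(2) by blast
  qed
qed

end

section \<open>Extension of the derivation\<close>

text \<open>\<open>T\<close> multiplies the term at \<open>t ^ b\<close> by \<open>w b\<close>. As
  \<open>t ^ L\<close> is a scalar, exponents reduce modulo \<open>L\<close>, and periodicity of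
  \<open>w\<close> makes the formula valid for all \<open>b\<close>.\<close>

lemma power_basis_operator:
  fixes F :: "'a::field set"
  assumes basis: "power_basis F UNIV L t" and F: "is_subfield F" and t: "t ^ L \<in> F" and L: "L > 0"
    and w: "\<And>b. w (b + L) = w b"
  shows "\<exists>T. (\<forall>x y. T (x + y) = T x + T y) \<and> (\<forall>e\<in>F. \<forall>b. T (e * t ^ b) = w b * (e * t ^ b))"
proof -
  have "\<forall>x. \<exists>f. (\<forall>b. f b \<in> F) \<and> x = (\<Sum>b<L. f b * t ^ b)"
    using basis unfolding power_basis_def by simp
  from choice[OF this] obtain f where f: "\<And>x b. f x b \<in> F" "\<And>x. x = (\<Sum>b<L. f x b * t ^ b)"
    by blast
  define T where "T x = (\<Sum>b<L. w b * (f x b * t ^ b))" for x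
  \<comment> \<open>By uniqueness any expansion of \<open>x\<close> computes \<open>T x\<close>,
    whichever one was chosen.\<close>
  have T: "T x = (\<Sum>b<L. w b * (g b * t ^ b))" if g: "\<And>b. g b \<in> F" "x = (\<Sum>b<L. g b * t ^ b)" for x g
  proof -
    have "(\<Sum>b<L. (f x b - g b) * t ^ b) = 0"
      by (simp only: left_diff_distrib sum_subtractf flip: f(2) g(2)) simp
    moreover have "\<forall>b. f x b - g b \<in> F" using subfield_diff[OF F] f(1) g(1) by simp
    ultimately have "(\<forall>b. f x b - g b \<in> F) \<and> (\<Sum>b<L. (f x b - g b) * t ^ b) = 0"
      by blast
    then have "\<forall>b<L. f x b - g b = 0"
      by (rule basis[unfolded power_basis_def, THEN conjunct2, THEN spec, THEN mp])
    then show ?thesis unfolding T_def by (intro sum.cong[OF refl]) simp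
  qed
  have add: "T (x + y) = T x + T y" for x y
  proof -
    have "T (x + y) = (\<Sum>b<L. w b * ((f x b + f y b) * t ^ b))"
    proof (rule T)
      show "x + y = (\<Sum>b<L. (f x b + f y b) * t ^ b)"
        by (simp only: distrib_right sum.distrib flip: f(2))
    qed (simp add: f(1) subfield_add[OF F])
    then show ?thesis by (simp add: T_def distrib_left distrib_right sum.distrib)
  qed
  have w_mod: "w b = w (b mod L)" for b
  proof -
    have "w (c + k * L) = w c" for c k
      by (induction k) (use w[of "c + _ * L"] in \<open>simp_all add: add.commute add.left_commute\<close>)
    from this[of "b mod L" "b div L"] show ?thesis by simp
  qed
  have "T (e * t ^ b) = w b * (e * t ^ b)" if e: "e \<in> F" for e b
  proof -
    \<comment> \<open>The basis expansion of \<open>e * t ^ b\<close> has a single term, at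
      \<open>b mod L\<close>; the full powers of \<open>t ^ L\<close> move into the
      coefficient.\<close>
    define g where "g c = (if c = b mod L then e * (t ^ L) ^ (b div L) else 0)" for c
    have "t ^ b = t ^ (L * (b div L) + b mod L)" by simp
    also have "\<dots> = (t ^ L) ^ (b div L) * t ^ (b mod L)" by (simp only: power_add power_mult)
    finally have tb: "t ^ b = (t ^ L) ^ (b div L) * t ^ (b mod L)" .
    have g: "g c * t ^ c = (if c = b mod L then e * t ^ b else 0)" for c
      unfolding g_def tb by simp
    have "T (e * t ^ b) = (\<Sum>c<L. w c * (g c * t ^ c))"
    proof (rule T)
      show "g c \<in> F" for c
        unfolding g_def using e t by (simp add: subfield_zero[OF F] subfield_mult[OF F] subfield_power[OF F])
      show "e * t ^ b = (\<Sum>c<L. g c * t ^ c)" unfolding g using L by simp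
    qed
    also have "\<dots> = (\<Sum>c<L. if c = b mod L then w b * (e * t ^ b) else 0)"
      by (rule sum.cong[OF refl]) (simp add: g flip: w_mod)
    finally show ?thesis using L by simp
  qed
  then show ?thesis using add by blast
qed

text \<open>\<open>exists_subfield_power_basis\<close> is iterated with
  \<open>x = t ^ p ^ (l + i)\<close>. It yields \<open>x ^ p\<close> outside the new subfield and
  \<open>(x ^ p) ^ p\<close> inside, which is the same situation with \<open>i + 1\<close>; the
  tower lemma multiplies the length of the basis by \<open>p\<close>.\<close>

lemma power_basis_subfield_chain:
  fixes M C :: "'a::field set"
  assumes p: "prime p" "CHAR('a) = p" and M: "is_subfield M" "separable_below M"
    and C: "is_subfield C" "M \<subseteq> C"
    and t: "t ^ p ^ l \<notin> C" "t ^ p ^ Suc l \<in> C" "power_basis C UNIV (p ^ Suc l) t"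
  shows "\<exists>F. F 0 = C \<and> (\<forall>i. is_subfield (F i) \<and> M \<subseteq> F i \<and> F (Suc i) \<subseteq> F i \<and>
    t ^ p ^ (Suc l + i) \<in> F i \<and> power_basis (F i) UNIV (p ^ (Suc l + i)) t)"
proof -
  \<comment> \<open>The last clause pins the start of the dependent choice to
    \<open>C\<close>.\<close>
  define P where "P i E \<longleftrightarrow> is_subfield E \<and> M \<subseteq> E \<and> t ^ p ^ (l + i) \<notin> E \<and> t ^ p ^ (Suc l + i) \<in> E \<and>
    power_basis E UNIV (p ^ (Suc l + i)) t \<and> (i = 0 \<longrightarrow> E = C)" for i E
  have "\<exists>F. \<forall>i. P i (F i) \<and> F (Suc i) \<subseteq> F i"
  proof (rule dependent_nat_choice)
    show "\<exists>E. P 0 E" unfolding P_def using C t by (intro exI[of _ C]) simp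
    fix E i assume "P i E"
    then have E: "is_subfield E" "M \<subseteq> E" "t ^ p ^ (l + i) \<notin> E" "t ^ p ^ (Suc l + i) \<in> E"
      "power_basis E UNIV (p ^ (Suc l + i)) t"
      unfolding P_def by blast+
    have pow: "(t ^ p ^ n) ^ p = t ^ p ^ Suc n" for n
      by (simp add: mult.commute flip: power_mult)
    from E(4) have "(t ^ p ^ (l + i)) ^ p \<in> E" by (simp only: pow add_Suc)
    from exists_subfield_power_basis[OF p M E(1,2,3) this]
    obtain E' where E': "is_subfield E'" "M \<subseteq> E'" "E' \<subseteq> E" "t ^ p ^ (l + Suc i) \<notin> E'"
      "t ^ p ^ (Suc l + Suc i) \<in> E'" "power_basis E' E p (t ^ p ^ (Suc l + i))"
      by (simp only: pow add_Suc add_Suc_right) blast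
    have "power_basis E' UNIV (p * p ^ (Suc l + i)) t"
      by (rule power_basis_tower[OF E'(6) E(5) E'(1,3) E(1,4)])
    then have "P (Suc i) E'" unfolding P_def using E' by simp
    then show "\<exists>E'. P (Suc i) E' \<and> E' \<subseteq> E" using E'(3) by blast
  qed
  then obtain F where "\<And>i. P i (F i) \<and> F (Suc i) \<subseteq> F i" by blast
  then show ?thesis unfolding P_def by (intro exI[of _ F]) simp
qed

theorem theorem4p11:
  fixes M :: "'a::field set" and p m :: nat and d :: "nat \<Rightarrow> 'a \<Rightarrow> 'a"
  assumes "CHAR('a) = p" and "p > 0"
    and "is_subfield M" and "separable_below M"
    and "m > 0"
    and "Gm_trunc_derivation m d"
    and "\<forall>n. 0 < n \<and> n < p ^ m \<longrightarrow> (\<forall>x\<in>M. d n x = 0)"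
  shows "\<exists>D :: nat \<Rightarrow> 'a \<Rightarrow> 'a.
           Gm_derivation D \<and> (\<forall>n>0. \<forall>x\<in>M. D n x = 0) \<and> (\<forall>i<p ^ m. D i = d i)"
proof -
  have p: "prime p" using prime_CHAR_semidom[where 'a = 'a] assms(1,2) by simp
  interpret Gm_trunc d p m "p ^ m"
    by unfold_locales (use p assms subfield_one[OF assms(3)] in auto)
  from trivial_or_power_basis show ?thesis
  proof (elim disjE exE conjE)
    assume trivial: "\<forall>n x. 0 < n \<longrightarrow> n < p ^ m \<longrightarrow> d n x = 0"
    \<comment> \<open>With all positive terms zero, the extension is the derivation of the grading
      concentrated in degree 0.\<close>
    define D :: "nat \<Rightarrow> 'a \<Rightarrow> 'a" where "D n x = (if n = 0 then x else 0)" for n x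
    have "Gm_derivation D"
    proof (rule Gm_derivation_if_graded[where H = "\<lambda>N a. if a = 0 then UNIV else {}"])
      show "\<exists>(L::nat) z (a::nat \<Rightarrow> nat). (\<forall>b<L. z b \<in> (if a b = 0 then UNIV else {})) \<and> x = (\<Sum>b<L. z b)"
        for x :: 'a
        by (intro exI[of _ "1::nat"] exI[of _ "\<lambda>_. x"] exI[of _ "\<lambda>_. 0::nat"]) simp
    qed (auto simp: D_def binomial_eq_0 split: if_splits)
    moreover have "D i = d i" if "i < p ^ m" for i
      using trivial that d_0 by (cases "i = 0") (auto simp: D_def)
    ultimately show ?thesis by (intro exI[of _ D]) (simp add: D_def)
  next
    fix k t
    assume k: "k < m" and tk: "t \<in> homogeneous (p ^ k)"
      and t: "t ^ p ^ (m - k) \<in> homogeneous 0" "t ^ p ^ (m - k - 1) \<notin> homogeneous 0"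
        "power_basis (homogeneous 0) UNIV (p ^ (m - k)) t"
    define l where "l = m - k - 1"
    have l: "m - k = Suc l" using k by (simp add: l_def)
    have M0: "M \<subseteq> homogeneous 0"
    proof
      fix x assume x: "x \<in> M"
      have "d n x = of_nat (0 choose n) * x" if "n < p ^ m" for n
      proof (cases "n = 0")
        case False
        then have "d n x = 0" using assms(7) x that by blast
        then show ?thesis using False by (simp add: binomial_eq_0)
      qed (simp add: d_0)
      then show "x \<in> homogeneous 0" by (simp add: homogeneous_def)
    qed
    have "t ^ p ^ l \<notin> homogeneous 0" "t ^ p ^ Suc l \<in> homogeneous 0"
      "power_basis (homogeneous 0) UNIV (p ^ Suc l) t"
      using t unfolding l_def[symmetric] l by simp_all
    from power_basis_subfield_chain[OF p assms(1,3,4) subfield_homogeneous_0 M0 this]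
    obtain F where F0: "F 0 = homogeneous 0"
      and F: "\<And>i. is_subfield (F i)" "\<And>i. M \<subseteq> F i" "\<And>i. F (Suc i) \<subseteq> F i"
        "\<And>i. t ^ p ^ (Suc l + i) \<in> F i" "\<And>i. power_basis (F i) UNIV (p ^ (Suc l + i)) t"
      by blast
    have F_mono: "F i \<subseteq> F n" if "n \<le> i" for n i
      using lift_Suc_antimono_le[of F, OF F(3) that] .
    \<comment> \<open>\<open>D n\<close> is defined through the grading over \<open>F n\<close>, in
      which \<open>e * t ^ b\<close> has degree \<open>p ^ k * b\<close> modulo
      \<open>p ^ (m + n)\<close>.\<close>
    have "\<exists>T. (\<forall>x y. T (x + y) = T x + T y) \<and>
        (\<forall>e\<in>F n. \<forall>b. T (e * t ^ b) = of_nat ((p ^ k * b) choose n) * (e * t ^ b))" for n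
    proof (rule power_basis_operator[OF F(5,1,4)])
      show "p ^ (Suc l + n) > 0" using assms(2) by simp
      fix b
      \<comment> \<open>The period \<open>p ^ (m + n)\<close> of the degrees must exceed
        \<open>n\<close> for the binomial coefficient to be periodic.\<close>
      have "n < p ^ n" using prime_gt_1_nat[OF p] by (intro power_gt_expt) simp
      also have "p ^ n \<le> p ^ (m + n)" using assms(2) by (intro power_increasing) auto
      finally have n: "n < p ^ (m + n)" .
      have "k + (Suc l + n) = m + n" using l k by simp
      then have "p ^ k * (b + p ^ (Suc l + n)) = p ^ k * b + p ^ (m + n)"
        by (simp only: distrib_left power_add[symmetric])
      then show "of_nat ((p ^ k * (b + p ^ (Suc l + n))) choose n) = (of_nat ((p ^ k * b) choose n) :: 'a)"
        using of_nat_choose_add_char_power[OF p assms(1) n] by simp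
    qed
    then have "\<forall>n. \<exists>T. (\<forall>x y. T (x + y) = T x + T y) \<and>
        (\<forall>e\<in>F n. \<forall>b. T (e * t ^ b) = of_nat ((p ^ k * b) choose n) * (e * t ^ b))" by blast
    from choice[OF this] obtain D where add: "\<And>n x y. D n (x + y) = D n x + D n y"
      and D: "\<And>n e b. e \<in> F n \<Longrightarrow> D n (e * t ^ b) = of_nat ((p ^ k * b) choose n) * (e * t ^ b)"
      by (elim exE) blast
    have span: "\<exists>f. (\<forall>b. f b \<in> F N) \<and> x = (\<Sum>b<p ^ (Suc l + N). f b * t ^ b)" for N x
      using F(5)[of N] unfolding power_basis_def by blast
    \<comment> \<open>The constants \<open>F N\<close> lie in \<open>F n\<close> for all
      \<open>n \<le> N\<close>, so the monomials over \<open>F N\<close> are eigenvectors of all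
      these \<open>D n\<close> at once.\<close>
    define H where "H N a = {z. \<exists>e b. e \<in> F N \<and> a = p ^ k * b \<and> z = e * t ^ b}" for N a
    have "Gm_derivation D"
    proof (rule Gm_derivation_if_graded[where H = H, OF add])
      show "D n z = of_nat (a choose n) * z" if nz: "n \<le> N" "z \<in> H N a" for N n a z
      proof -
        obtain e b where e: "e \<in> F N" "a = p ^ k * b" "z = e * t ^ b" using nz(2) unfolding H_def by blast
        then show ?thesis using D[of e n b] F_mono[OF nz(1)] by blast
      qed
      show "x * y \<in> H N (a + a')" if xy: "x \<in> H N a" "y \<in> H N a'" for N a a' x y
      proof -
        obtain e b e' b' where e: "e \<in> F N" "a = p ^ k * b" "x = e * t ^ b"
          and e': "e' \<in> F N" "a' = p ^ k * b'" "y = e' * t ^ b'"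
          using xy unfolding H_def by blast
        have "e * e' \<in> F N" using subfield_mult[OF F(1) e(1) e'(1)] .
        moreover have "a + a' = p ^ k * (b + b')" using e e' by (simp add: distrib_left)
        moreover have "x * y = (e * e') * t ^ (b + b')" using e e' by (simp add: power_add mult_ac)
        ultimately show ?thesis unfolding H_def by blast
      qed
      show "\<exists>(L::nat) z a. (\<forall>b<L. z b \<in> H N (a b)) \<and> x = (\<Sum>b<L. z b)" for N x
      proof -
        obtain f where f: "\<forall>b. f b \<in> F N" "x = (\<Sum>b<p ^ (Suc l + N). f b * t ^ b)" using span by blast
        have "f b * t ^ b \<in> H N (p ^ k * b)" for b using f(1) unfolding H_def by blast
        then show ?thesis
          using f(2) by (intro exI[of _ "p ^ (Suc l + N)"] exI[of _ "\<lambda>b. f b * t ^ b"] exI[of _ "\<lambda>b. p ^ k * b"]) simp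
      qed
    qed
    \<comment> \<open>An element of \<open>M\<close> is the monomial \<open>x * t ^ 0\<close> over
      \<open>F n\<close>, of degree 0.\<close>
    moreover have "D n x = 0" if n: "n > 0" and x: "x \<in> M" for n x
      using D[of x n 0] F(2)[of n] x n by (auto simp: binomial_eq_0)
    moreover have "D n = d n" if n: "n < p ^ m" for n
    proof
      fix x
      \<comment> \<open>The coefficients from \<open>F n\<close> lie in \<open>F 0\<close>, the
        constants of \<open>d\<close>, so the monomials are homogeneous for \<open>d\<close> too, of
        the same degree.\<close>
      obtain f where f: "\<forall>b. f b \<in> F n" "x = (\<Sum>b<p ^ (Suc l + n). f b * t ^ b)" using span by blast
      have "D n (f b * t ^ b) = d n (f b * t ^ b)" for b
      proof -
        have "f b \<in> homogeneous 0" using f(1) F_mono[of 0 n] F0 by blast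
        then have "f b * t ^ b \<in> homogeneous (0 + p ^ k * b)"
          by (intro homogeneous_mult homogeneous_power tk)
        then show ?thesis using D[of "f b" n b] f(1) homogeneousD[OF _ n] by simp
      qed
      then show "D n x = d n x"
        unfolding f(2) d_sum[OF n] additive_sum[of "D n", OF add] by simp
    qed
    ultimately show ?thesis by blast
  qed
qed

end
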